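(* Let $q\ge 2$ be an integer, let $a>0$ be real and let $\mathbf{x}_0=(x_1,\dots,x_q)\in\mathbb{R}_{>0}^q$. Let $(\mathbf{X}_n)_{n\ge0}$ be the Pólya urn with $q$ colours, replacement parameter $a$ and initial state $\mathbf{X}_0=\mathbf{x}_0$, let $\mathbf{Y}_n$ be the vector of numbers of draws of each colour among the first $n$ draws, and let $\mathbf{W}\sim\mathrm{Dir}(\mathbf{x}_0/a)$, i.e. $\mathbf W\sim \mathrm{Dir}(x_1/a,\dots,x_q/a)$. Then there exist constants $0<c\le C<\infty$, which may depend on $q$, $a$ and $\mathbf{x}_0$ but not on $n$ or $p$, such that for every $p\in[1,\infty]$ and all integers $n\ge1$, $$\frac{c}{n}\le \ell_p\Bigl(\frac{\mathbf{X}_n}{|\mathbf{X}_n|},\mathbf{W}\Bigr)\le\frac{C}{n}\qquad\text{and}\qquad \frac{c}{n}\le \ell_p\Bigl(\frac{\mathbf{Y}_n}{n},\mathbf{W}\Bigr)\le\frac{C}{n}.$$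
   Context: Norm: for $\mathbf{x}\in\mathbb{R}^q$, $|\mathbf{x}|:=\sum_{i=1}^q|x_i|$. Pólya urn: given $q\ge2$, $a>0$ and $\mathbf{x}_0\in\mathbb{R}_{>0}^q$ (the entries need not be integers), the urn is the Markov chain $\mathbf{X}_n=(X_{n,1},\dots,X_{n,q})$, $n\ge0$, in $\mathbb{R}_{>0}^q$ with deterministic initial value $\mathbf{X}_0=\mathbf{x}_0$ and transition probabilities $$\mathbb{P}(\mathbf{X}_{n+1}=\mathbf{X}_n+a\mathbf{e}_i\mid\mathbf{X}_n)=\frac{X_{n,i}}{|\mathbf{X}_n|},\qquad i=1,\dots,q,$$ where $\mathbf{e}_1,\dots,\mathbf{e}_q$ are the standard unit vectors. Thus $|\mathbf{X}_n|=an+|\mathbf{x}_0|$ is deterministic. The vector $\mathbf{Y}_n=(Y_{n,1},\dots,Y_{n,q})$, where $Y_{n,i}$ is the number of steps among the first $n$ in which colour $i$ is drawn (i.e. $a\mathbf{e}_i$ is added), satisfies $\mathbf{X}_n=\mathbf{x}_0+a\mathbf{Y}_n$. Dirichlet distribution: for $\alpha_1,\dots,\alpha_q>0$, $\mathrm{Dir}(\alpha_1,\dots,\alpha_q)$ is the distribution on the simplex $\{(x_1,\dots,x_q)\in\mathbb{R}_{>0}^q:\sum_i x_i=1\}$ with density $\frac{\Gamma(\alpha_1+\dots+\alpha_q)}{\Gamma(\alpha_1)\cdots\Gamma(\alpha_q)}x_1^{\alpha_1-1}\cdots x_q^{\alpha_q-1}$ with respect to $\mathrm{d}x_1\cdots\mathrm{d}x_{q-1}$.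 Minimal $L_p$ distance: for random vectors $X,Y$ in $\mathbb{R}^q$ and $p\in[1,\infty]$, $\ell_p(X,Y):=\inf\{\|X'-Y'\|_p\}$, the infimum being over all pairs $(X',Y')$ of random vectors defined on a common probability space with $X'$ distributed as $X$ and $Y'$ distributed as $Y$; here $\|X'-Y'\|_p=(\mathbb{E}|X'-Y'|^p)^{1/p}$ for $p<\infty$, and $\|X'-Y'\|_\infty$ is the essential supremum of $|X'-Y'|$. It depends only on the distributions of $X$ and $Y$. *)

theory Defs
  imports "HOL-Probability.Probability" "HOL-Probability.Essential_Supremum"
begin

text \<open>The library norm on \<^typ>\<open>real^'q\<close> is Euclidean; distances here are measured in the \<open>\<ell>\<^sup>1\<close> norm.\<close>

definition l1norm :: "real^'q \<Rightarrow> real" where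
  "l1norm x = (\<Sum>i\<in>UNIV. \<bar>x $ i\<bar>)"


section \<open>The urn\<close>

text \<open>
  The urn process is almost surely discrete at each time, so the transition probabilities can be
  given by elementary conditioning. Conditioning on the whole history rather than on the
  present state makes this the Markov property as well.
\<close>

definition polya_urn ::
  "'w measure \<Rightarrow> real \<Rightarrow> real^'q \<Rightarrow> (nat \<Rightarrow> 'w \<Rightarrow> real^'q) \<Rightarrow> bool" where
  "polya_urn M a x\<^sub>0 X \<longleftrightarrow>
     prob_space M \<and>
     (\<forall>n. X n \<in> borel_measurable M) \<and>
     (AE \<omega> in M. X 0 \<omega> = x\<^sub>0) \<and>
     (\<forall>n s i. \<P>(\<omega> in M. \<forall>k\<le>n. X k \<omega> = s k) > 0 \<longrightarrow>
        \<P>(\<omega> in M. X (Suc n) \<omega> = s n + a *\<^sub>R axis i 1 \<bar> \<forall>k\<le>n. X k \<omega> = s k)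
          = s n $ i / l1norm (s n))"

definition draws :: "real \<Rightarrow> (nat \<Rightarrow> 'w \<Rightarrow> real^'q) \<Rightarrow> nat \<Rightarrow> 'w \<Rightarrow> real^'q" where
  "draws a X n \<omega> = (\<chi> i. real (card {k. k < n \<and> X (Suc k) \<omega> = X k \<omega> + a *\<^sub>R axis i 1}))"


section \<open>The Dirichlet distribution\<close>

text \<open>
  The index type carries no order, so there is no last coordinate to omit from
  \<open>dx\<^sub>1 \<dots> dx\<^bsub>q-1\<^esub>\<close>. The omitted coordinate is therefore a parameter \<open>k\<close>:
  \<open>hyperplane_lborel k\<close> is Lebesgue measure in the coordinates other than \<open>k\<close>, transported to the
  hyperplane where the coordinates sum to 1. The measure does not depend on \<open>k\<close>.
\<close>

definition hyperplane_lborel :: "'q::finite \<Rightarrow> (real^'q) measure" where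
  "hyperplane_lborel k =
     distr (\<Pi>\<^sub>M j\<in>UNIV - {k}. lborel) borel
       (\<lambda>y. \<chi> i. if i = k then 1 - (\<Sum>j\<in>UNIV - {k}. y j) else y i)"

definition dirichlet_density :: "real^'q \<Rightarrow> real^'q \<Rightarrow> real" where
  "dirichlet_density \<alpha> x =
     (if \<forall>i. x $ i > 0
      then Gamma (\<Sum>i\<in>UNIV. \<alpha> $ i) / (\<Prod>i\<in>UNIV. Gamma (\<alpha> $ i))
             * (\<Prod>i\<in>UNIV. (x $ i) powr (\<alpha> $ i - 1))
      else 0)"

definition dirichlet :: "'q::finite \<Rightarrow> real^'q \<Rightarrow> (real^'q) measure" where
  "dirichlet k \<alpha> = density (hyperplane_lborel k) (\<lambda>x. ennreal (dirichlet_density \<alpha> x))"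


section \<open>The minimal \<open>L\<^sub>p\<close> distance\<close>

definition ennreal_powr :: "ennreal \<Rightarrow> real \<Rightarrow> ennreal" where
  "ennreal_powr x r = (if x = \<infinity> then \<infinity> else ennreal (enn2real x powr r))"

definition Lp_norm :: "ennreal \<Rightarrow> 'w measure \<Rightarrow> ('w \<Rightarrow> real^'q) \<Rightarrow> ennreal" where
  "Lp_norm p M Z =
     (if p = \<infinity> then esssup M (\<lambda>\<omega>. ennreal (l1norm (Z \<omega>)))
      else ennreal_powr (\<integral>\<^sup>+\<omega>. ennreal (l1norm (Z \<omega>) powr enn2real p) \<partial>M) (1 / enn2real p))"

text \<open>
  The infimum over all probability spaces is restricted to spaces on the type of pairs of vectors;
  by the lemma \<open>lp_dist_le\<close> below this loses nothing, since any pair \<open>(X', Y')\<close> can be replaced by the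
  coordinate projections under its joint law.
\<close>

definition lp_dist :: "ennreal \<Rightarrow> (real^'q) measure \<Rightarrow> (real^'q) measure \<Rightarrow> ennreal" where
  "lp_dist p \<mu> \<nu> =
     Inf {Lp_norm p M (\<lambda>\<omega>. X' \<omega> - Y' \<omega>) | (M :: ((real^'q) \<times> (real^'q)) measure) X' Y'.
            prob_space M \<and> X' \<in> borel_measurable M \<and> Y' \<in> borel_measurable M \<and>
            distr M borel X' = \<mu> \<and> distr M borel Y' = \<nu>}"

lemma borel_measurable_l1norm [measurable]: "l1norm \<in> borel_measurable borel"
  unfolding l1norm_def by (intro borel_measurable_continuous_onI continuous_intros)

lemma Lp_norm_distr:
  assumes T: "T \<in> measurable M N" and Z[measurable]: "Z \<in> borel_measurable N"
  shows "Lp_norm p (distr M N T) Z = Lp_norm p M (\<lambda>\<omega>. Z (T \<omega>))"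
proof -
  note T[measurable]
  have 1: "esssup (distr M N T) f = esssup M (\<lambda>\<omega>. f (T \<omega>))"
    if f[measurable]: "f \<in> borel_measurable N" for f :: "_ \<Rightarrow> ennreal"
    by (subst (1 2) esssup_eq_AE) (auto simp: AE_distr_iff)
  show ?thesis
    unfolding Lp_norm_def by (subst 1) (auto simp: nn_integral_distr)
qed

lemma lp_dist_le:
  fixes X' Y' :: "'w \<Rightarrow> real^'q"
  assumes "prob_space M" and X[measurable]: "X' \<in> borel_measurable M"
    and Y[measurable]: "Y' \<in> borel_measurable M"
  shows "lp_dist p (distr M borel X') (distr M borel Y') \<le> Lp_norm p M (\<lambda>\<omega>. X' \<omega> - Y' \<omega>)"
proof -
  interpret prob_space M by fact
  let ?N = "distr M (borel \<Otimes>\<^sub>M borel) (\<lambda>\<omega>. (X' \<omega>, Y' \<omega>))"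
  have "prob_space ?N" by (intro prob_space_distr) simp
  moreover have "Lp_norm p M (\<lambda>\<omega>. X' \<omega> - Y' \<omega>) = Lp_norm p ?N (\<lambda>z. fst z - snd z)"
    by (subst Lp_norm_distr) simp_all
  moreover have "distr ?N borel fst = distr M borel X'" "distr ?N borel snd = distr M borel Y'"
    by (simp_all add: distr_distr comp_def)
  moreover have "fst \<in> borel_measurable ?N" "snd \<in> borel_measurable ?N"
    by simp_all
  ultimately show ?thesis
    unfolding lp_dist_def by (intro Inf_lower CollectI exI[of _ ?N] exI[of _ fst] exI[of _ snd] conjI)
qed

end

theory Submission
  imports Defs
begin

text \<open>
  Upper bound. For two colours let \<open>F\<close> be the beta distribution function and \<open>G\<^sub>n\<close> that of the
  beta-binomial law of the number of draws. Integrating by parts the mixture representation over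
  binomial laws gives \<open>G\<^sub>n m = \<integral> F \<kappa>\<close> for the beta density \<open>\<kappa>\<close> with parameters \<open>m + 1\<close> and \<open>n - m\<close>.
  For an integer \<open>j \<ge> \<alpha>\<close>, \<open>F\<close> is concave as a function of \<open>(x / (1 - x)) ^ j\<close>, and the \<open>\<kappa>\<close>-mean of
  the latter is at most its value at \<open>x = (m + j) / n\<close>; hence \<open>G\<^sub>n m \<le> F ((m + j) / n)\<close> by Jensen's
  inequality, and exchanging the colours gives the reverse bound. So the monotone rearrangement
  keeps a beta variable within \<open>j / n\<close> of the draw frequency. Stick breaking factorises the
  Dirichlet and the Dirichlet-multinomial law in the same way, and iterating the two-colour coupling
  yields a coupling within \<open>C / n\<close> almost surely, which is good for all \<open>p\<close> at once.

  Lower bound. A coordinate of the urn takes at most \<open>n + 1 \<le> 2 n\<close> values, while the matching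
  coordinate of the limit has a beta density bounded on \<open>[1/4, 3/4]\<close>, so it stays at distance
  \<open>\<epsilon> / n\<close> from all of them with probability bounded below.
\<close>

section \<open>Beta and beta-binomial distributions\<close>

text \<open>A beta density may vanish at 0 or 1, and then a bound of order 1/n between the values of
  two distribution functions gives no bound of that order between their quantiles. The comparison is
  therefore made in the argument: F is shifted by j / n. Concavity of F itself fails for general
  parameters. Passing to the j-th power of the odds divides the density by a multiple of x^(j-1) /
  (1-x)^(j+1), and the quotient, a multiple of x^(\<alpha>-j) (1-x)^(\<beta>+j), decreases as soon
  as j \<ge> \<alpha>, whatever \<beta> > 0 is. An integer j makes the odds moment of the kernel a
  quotient of factorials, which can be bounded factor by factor.

  In stick breaking, the number of draws left for the other colours depends on the point that is
  being rounded, so the coupling is built for all n together with a single constant. The errors of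
  successive sticks only add up, because each is passed on multiplied by a proportion of at most
  1.\<close>

definition polya_weight :: "real \<Rightarrow> nat \<Rightarrow> real" where
  "polya_weight \<alpha> n = pochhammer \<alpha> n / fact n"

text \<open>\<open>polya_weight \<alpha> n\<close> is the coefficient of t^n in (1 - t)^(-\<alpha>);
  its factorials supply the binomial coefficient here. With \<alpha> and \<beta> the initial
  contents divided by the replacement number, this is the chance of k draws of the first colour
  among n draws from a two-colour urn.\<close>

definition beta_binomial :: "real \<Rightarrow> real \<Rightarrow> nat \<Rightarrow> nat \<Rightarrow> real" where
  "beta_binomial \<alpha> \<beta> n k = polya_weight \<alpha> k * polya_weight \<beta> (n - k) / polya_weight (\<alpha> + \<beta>) n"

definition beta_density :: "real \<Rightarrow> real \<Rightarrow> real \<Rightarrow> real" where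
  "beta_density \<alpha> \<beta> x =
     (if 0 < x \<and> x < 1 then x powr (\<alpha> - 1) * (1 - x) powr (\<beta> - 1) / Beta \<alpha> \<beta> else 0)"

text \<open>For x < 0 the interval is empty and the value is 0, and the density is 0 beyond 1, so
  starting the integral at 0 still gives a distribution function on the whole line.\<close>

definition beta_cdf :: "real \<Rightarrow> real \<Rightarrow> real \<Rightarrow> real" where
  "beta_cdf \<alpha> \<beta> x = integral {0..x} (beta_density \<alpha> \<beta>)"

lemma polya_weight_0 [simp]: "polya_weight \<alpha> 0 = 1"
  by (simp add: polya_weight_def)

lemma polya_weight_Suc:
  "polya_weight \<alpha> (Suc n) = polya_weight \<alpha> n * (\<alpha> + real n) / real (Suc n)"
  by (simp add: polya_weight_def pochhammer_Suc field_simps)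

lemma polya_weight_pos: "0 < \<alpha> \<Longrightarrow> 0 < polya_weight \<alpha> n"
  by (simp add: polya_weight_def pochhammer_pos)

lemma polya_weight_Gamma:
  "0 < \<alpha> \<Longrightarrow> polya_weight \<alpha> n = Gamma (\<alpha> + real n) / (Gamma \<alpha> * fact n)"
  by (subst polya_weight_def, subst pochhammer_Gamma) (auto elim!: nonpos_Ints_cases)

lemma Beta_real_pos: "0 < \<alpha> \<Longrightarrow> 0 < \<beta> \<Longrightarrow> 0 < Beta \<alpha> (\<beta>::real)"
  by (simp add: Beta_def)

lemma beta_binomial_nonneg: "0 < \<alpha> \<Longrightarrow> 0 < \<beta> \<Longrightarrow> 0 \<le> beta_binomial \<alpha> \<beta> n k"
  by (simp add: beta_binomial_def polya_weight_pos less_imp_le)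

lemma beta_binomial_commute: "k \<le> n \<Longrightarrow> beta_binomial \<alpha> \<beta> n k = beta_binomial \<beta> \<alpha> n (n - k)"
  by (simp add: beta_binomial_def add.commute mult.commute)

lemma beta_density_nonneg: "0 < \<alpha> \<Longrightarrow> 0 < \<beta> \<Longrightarrow> 0 \<le> beta_density \<alpha> \<beta> x"
  using Beta_real_pos[of \<alpha> \<beta>] by (simp add: beta_density_def)

lemma beta_density_measurable [measurable]: "beta_density \<alpha> \<beta> \<in> borel_measurable borel"
  unfolding beta_density_def[abs_def] by measurable

lemma beta_density_commute: "beta_density \<alpha> \<beta> (1 - x) = beta_density \<beta> \<alpha> x"
  by (simp add: beta_density_def Beta_commute mult.commute)

lemma has_integral_power_Beta:
  "((\<lambda>x::real. x ^ p * (1 - x) ^ q) has_integral (fact p * fact q / fact (p + q + 1))) {0..1}"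
proof -
  have "Beta (real p + 1) (real q + 1) = fact p * fact q / fact (p + q + 1)"
    using Gamma_fact[of p, where 'a=real] Gamma_fact[of q, where 'a=real] Gamma_fact[of "p+q+1", where 'a=real]
    by (simp add: Beta_def add_ac)
  then have *: "((\<lambda>t. t powr real p * (1 - t) powr real q) has_integral fact p * fact q / fact (p + q + 1)) {0..1}"
    using has_integral_Beta_real[of "real p + 1" "real q + 1"] by simp
  show ?thesis
    \<comment> \<open>\<open>0 powr 0\<close> is 0 while \<open>0 ^ 0\<close> is 1, so the two
      integrands may differ at the endpoints.\<close>
    by (rule has_integral_spike_finite[OF _ _ *, of "{0,1}"]) (auto simp: powr_realpow)
qed

context
  fixes \<alpha> \<beta> :: real
  assumes \<alpha>: "0 < \<alpha>" and \<beta>: "0 < \<beta>"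
begin

text \<open>Multiplying the beta density by x^k (1-x)^(n-k) only shifts its two parameters, so the
  integral is a quotient of Beta values. This is the mixture representation: a binomial law whose
  success probability is beta distributed.\<close>

lemma has_integral_beta_binomial:
  assumes "k \<le> n"
  shows "((\<lambda>x. beta_density \<alpha> \<beta> x * (real (n choose k) * x ^ k * (1 - x) ^ (n - k)))
           has_integral beta_binomial \<alpha> \<beta> n k) {0..1}"
proof -
  define f where "f t = t powr (\<alpha> + real k - 1) * (1 - t) powr (\<beta> + real (n - k) - 1)" for t
  define c where "c = real (n choose k) / Beta \<alpha> \<beta>"
  have "(f has_integral Beta (\<alpha> + real k) (\<beta> + real (n - k))) {0..1}"
    unfolding f_def using \<alpha> \<beta> by (intro has_integral_Beta_real) auto
  then have "((\<lambda>t. c * f t) has_integral c * Beta (\<alpha> + real k) (\<beta> + real (n - k))) {0..1}"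
    by (rule has_integral_mult_right)
  also have "c * Beta (\<alpha> + real k) (\<beta> + real (n - k)) = beta_binomial \<alpha> \<beta> n k"
  proof -
    have 1: "\<alpha> + real k + (\<beta> + real (n - k)) = \<alpha> + \<beta> + real n" using assms by simp
    have "Gamma \<alpha> > 0" "Gamma \<beta> > 0" "Gamma (\<alpha> + \<beta>) > 0" "Gamma (\<alpha> + \<beta> + real n) > 0"
      using \<alpha> \<beta> by (auto intro!: Gamma_real_pos)
    then show ?thesis
      unfolding beta_binomial_def c_def Beta_def 1 using \<alpha> \<beta> assms
      by (simp add: polya_weight_Gamma binomial_fact field_simps)
  qed
  finally have *: "((\<lambda>t. c * f t) has_integral beta_binomial \<alpha> \<beta> n k) {0..1}" .
  show ?thesis
  proof (rule has_integral_spike_finite[OF _ _ *])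
    show "beta_density \<alpha> \<beta> x * (real (n choose k) * x ^ k * (1 - x) ^ (n - k)) = c * f x"
      if "x \<in> {0..1} - {0,1}" for x
    proof -
      have "x powr (\<alpha> + real k - 1) = x powr (\<alpha> - 1) * x ^ k"
        using that by (simp flip: powr_realpow powr_add) (simp add: algebra_simps)
      moreover have "(1-x) powr (\<beta> + real (n-k) - 1) = (1-x) powr (\<beta> - 1) * (1-x) ^ (n-k)"
        using that by (simp flip: powr_realpow powr_add) (simp add: algebra_simps)
      ultimately show ?thesis
        using that by (simp add: beta_density_def c_def f_def)
    qed
  qed simp
qed

lemma has_integral_beta_density: "(beta_density \<alpha> \<beta> has_integral 1) {0..1}"
  using has_integral_beta_binomial[of 0 0] by (simp add: beta_binomial_def)

text \<open>The binomial weights add up to 1 for each fixed success probability x; integrating over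
  x against the beta density keeps this.\<close>

lemma sum_beta_binomial: "(\<Sum>k\<le>n. beta_binomial \<alpha> \<beta> n k) = 1"
proof (rule has_integral_unique)
  show "((\<lambda>x. \<Sum>k\<le>n. beta_density \<alpha> \<beta> x * (real (n choose k) * x ^ k * (1 - x) ^ (n - k)))
           has_integral (\<Sum>k\<le>n. beta_binomial \<alpha> \<beta> n k)) {0..1}"
    by (intro has_integral_sum has_integral_beta_binomial) auto
  have "(\<Sum>k\<le>n. beta_density \<alpha> \<beta> x * (real (n choose k) * x ^ k * (1 - x) ^ (n - k))) = beta_density \<alpha> \<beta> x" for x
    using binomial_ring[of x "1-x" n] by (simp flip: sum_distrib_left)
  then show "((\<lambda>x. \<Sum>k\<le>n. beta_density \<alpha> \<beta> x * (real (n choose k) * x ^ k * (1 - x) ^ (n - k)))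
           has_integral 1) {0..1}"
    using has_integral_beta_density by simp
qed

lemma beta_density_integrable: "beta_density \<alpha> \<beta> integrable_on {a..b}"
proof -
  have "(beta_density \<alpha> \<beta> has_integral 1) UNIV"
    by (rule has_integral_on_superset[OF has_integral_beta_density]) (auto simp: beta_density_def)
  then show ?thesis
    by (meson has_integral_integrable integrable_on_subinterval subset_UNIV)
qed

lemma beta_cdf_0 [simp]: "beta_cdf \<alpha> \<beta> 0 = 0"
  by (simp add: beta_cdf_def)

lemma beta_cdf_1 [simp]: "beta_cdf \<alpha> \<beta> 1 = 1"
  using has_integral_beta_density by (simp add: beta_cdf_def integral_unique)

lemma mono_beta_cdf: "mono (beta_cdf \<alpha> \<beta>)"
  unfolding beta_cdf_def
  by (intro monoI integral_subset_le beta_density_integrable ballI beta_density_nonneg \<alpha> \<beta>) auto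

lemma beta_cdf_measurable [measurable]: "beta_cdf \<alpha> \<beta> \<in> borel_measurable borel"
  by (rule borel_measurable_mono[OF mono_beta_cdf])

lemma continuous_on_beta_cdf: "continuous_on {0..b} (beta_cdf \<alpha> \<beta>)"
  unfolding beta_cdf_def[abs_def] by (intro indefinite_integral_continuous_1 beta_density_integrable)

text \<open>Interior points only, since the density may be unbounded near 0 and 1. Later
  monotonicity and integration arguments combine this with continuity of \<open>beta_cdf\<close> up
  to the boundary.\<close>

lemma DERIV_beta_cdf:
  assumes "0 < x" "x < 1"
  shows "(beta_cdf \<alpha> \<beta> has_real_derivative beta_density \<alpha> \<beta> x) (at x)"
proof -
  have "continuous_on {0<..<1} (\<lambda>x. x powr (\<alpha> - 1) * (1 - x) powr (\<beta> - 1) / Beta \<alpha> \<beta>)"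
    using Beta_real_pos[OF \<alpha> \<beta>] by (intro continuous_intros) auto
  also have "?this \<longleftrightarrow> continuous_on {0<..<1} (beta_density \<alpha> \<beta>)"
    by (intro continuous_on_cong) (auto simp: beta_density_def)
  finally have "isCont (beta_density \<alpha> \<beta>) x"
    using assms by (simp add: continuous_on_eq_continuous_at)
  then have "((\<lambda>u. integral {0..u} (beta_density \<alpha> \<beta>)) has_vector_derivative beta_density \<alpha> \<beta> x) (at x within {0..1} - {})"
    using assms by (intro integral_has_vector_derivative_continuous_at beta_density_integrable)
      (auto intro: continuous_at_imp_continuous_within)
  then show ?thesis
    using assms unfolding beta_cdf_def[abs_def] has_real_derivative_iff_has_vector_derivative
    by (simp add: at_within_Icc_at)
qed

lemma beta_cdf_strict_mono:
  assumes "0 \<le> x" "x < y" "y \<le> 1"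
  shows "beta_cdf \<alpha> \<beta> x < beta_cdf \<alpha> \<beta> y"
proof (rule DERIV_pos_imp_increasing_open[OF \<open>x < y\<close>])
  fix t assume "x < t" "t < y"
  then show "\<exists>d. (beta_cdf \<alpha> \<beta> has_real_derivative d) (at t) \<and> 0 < d"
    using assms Beta_real_pos[OF \<alpha> \<beta>]
    by (intro exI[of _ "beta_density \<alpha> \<beta> t"] conjI DERIV_beta_cdf) (auto simp: beta_density_def)
qed (use assms in \<open>auto intro: continuous_on_subset[OF continuous_on_beta_cdf[of y]]\<close>)

lemma beta_cdf_onto:
  assumes "0 \<le> t" "t \<le> 1"
  obtains u where "0 \<le> u" "u \<le> 1" "beta_cdf \<alpha> \<beta> u = t"
  using IVT'[of "beta_cdf \<alpha> \<beta>" 0 t 1] assms continuous_on_beta_cdf[of 1] by auto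

end

lemma beta_cdf_commute:
  assumes "0 < \<alpha>" "0 < \<beta>" "0 \<le> x" "x \<le> 1"
  shows "beta_cdf \<alpha> \<beta> (1 - x) = 1 - beta_cdf \<beta> \<alpha> x"
proof -
  have "(beta_density \<beta> \<alpha> has_integral beta_cdf \<beta> \<alpha> x) {0..x}"
    unfolding beta_cdf_def by (intro integrable_integral beta_density_integrable assms)
  then have "((\<lambda>t. beta_density \<beta> \<alpha> (1 - t)) has_integral beta_cdf \<beta> \<alpha> x) {1 - x..1}"
    using has_integral_affinity[of "beta_density \<beta> \<alpha>" "beta_cdf \<beta> \<alpha> x" 0 x "-1" 1] by simp
  then have "(beta_density \<alpha> \<beta> has_integral beta_cdf \<beta> \<alpha> x) {1 - x..1}"
    by (simp add: beta_density_commute)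
  moreover have "(beta_density \<alpha> \<beta> has_integral beta_cdf \<alpha> \<beta> (1 - x)) {0..1 - x}"
    unfolding beta_cdf_def by (intro integrable_integral beta_density_integrable assms)
  ultimately have "(beta_density \<alpha> \<beta> has_integral beta_cdf \<alpha> \<beta> (1 - x) + beta_cdf \<beta> \<alpha> x) {0..1}"
    using assms by (intro has_integral_combine[of 0 "1 - x" 1]) auto
  from has_integral_unique[OF this has_integral_beta_density[OF assms(1,2)]] show ?thesis
    by simp
qed

section \<open>Comparison of the distribution functions\<close>

text \<open>The derivative of each binomial weight is a difference of two neighbouring kernels, so
  the sum telescopes. What is left is minus the beta density with parameters m + 1 and n -
  m.\<close>

lemma DERIV_binomial_tail:
  assumes "m < n"
  shows "((\<lambda>x. \<Sum>k\<le>m. real (n choose k) * x ^ k * (1 - x) ^ (n - k)) has_real_derivative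
           - (real n * real ((n - 1) choose m) * x ^ m * (1 - x) ^ (n - 1 - m))) (at x)"
  using assms
proof (induction m)
  case 0
  then show ?case by (auto intro!: derivative_eq_intros)
next
  case (Suc m)
  \<comment> \<open>The absorption identities rewrite the two product-rule coefficients as those of
    the kernels with index m and \<open>Suc m\<close>; the former then cancels against the induction
    hypothesis.\<close>
  have c1: "real (n choose Suc m) * (1 + real m) = real n * real ((n - 1) choose m)"
    using binomial_absorption[of m n] by (metis mult.commute of_nat_Suc of_nat_mult)
  have c2: "real (n choose Suc m) * real (n - Suc m) = real n * real ((n - 1) choose Suc m)"
    using binomial_absorb_comp[of n "Suc m"] by (metis mult.commute of_nat_mult)
  have "((\<lambda>x. real (n choose Suc m) * x ^ Suc m * (1 - x) ^ (n - Suc m)) has_real_derivative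
      real (n choose Suc m) * (1 + real m) * x ^ m * (1 - x) ^ (n - 1 - m)
      - real (n choose Suc m) * real (n - Suc m) * x ^ Suc m * (1 - x) ^ (n - 1 - Suc m)) (at x)"
  proof -
    have "((\<lambda>x. x ^ Suc m) has_real_derivative (1 + real m) * x ^ m) (at x)"
      using DERIV_pow[of "Suc m" x] by simp
    moreover have "((\<lambda>x. (1 - x) ^ (n - Suc m)) has_real_derivative
        - (real (n - Suc m) * (1 - x) ^ (n - 1 - Suc m))) (at x)"
      by (auto intro!: derivative_eq_intros)
    ultimately show ?thesis
      by (intro DERIV_cong[OF DERIV_mult[OF DERIV_cmult]]) (auto simp: algebra_simps)
  qed
  then have "((\<lambda>x. real (n choose Suc m) * x ^ Suc m * (1 - x) ^ (n - Suc m)) has_real_derivative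
      real n * real ((n - 1) choose m) * x ^ m * (1 - x) ^ (n - 1 - m)
      - real n * real ((n - 1) choose Suc m) * x ^ Suc m * (1 - x) ^ (n - 1 - Suc m)) (at x)"
    unfolding c1 c2 .
  with Suc have "((\<lambda>x. (\<Sum>k\<le>m. real (n choose k) * x ^ k * (1 - x) ^ (n - k))
      + real (n choose Suc m) * x ^ Suc m * (1 - x) ^ (n - Suc m)) has_real_derivative
      - (real n * real ((n - 1) choose m) * x ^ m * (1 - x) ^ (n - 1 - m))
      + (real n * real ((n - 1) choose m) * x ^ m * (1 - x) ^ (n - 1 - m)
      - real n * real ((n - 1) choose Suc m) * x ^ Suc m * (1 - x) ^ (n - 1 - Suc m))) (at x)"
    by (intro DERIV_add) auto
  then show ?case by simp
qed

text \<open>The integrand is the beta density with parameters m + 1 and n - m times (x / (1 - x))^j,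
  so this is its j-th odds moment. The case j = 0 gives total mass 1.\<close>

lemma has_integral_binomial_kernel:
  assumes "m + j < n"
  shows "((\<lambda>x::real. real n * real ((n - 1) choose m) * x ^ (m + j) * (1 - x) ^ (n - 1 - m - j)) has_integral
           (fact (m + j) / fact m) * (fact (n - 1 - m - j) / fact (n - 1 - m))) {0..1}"
proof -
  have "((\<lambda>x::real. real n * real ((n - 1) choose m) * (x ^ (m + j) * (1 - x) ^ (n - 1 - m - j))) has_integral
      real n * real ((n - 1) choose m) *
      (fact (m + j) * fact (n - 1 - m - j) / fact (m + j + (n - 1 - m - j) + 1))) {0..1}"
    by (intro has_integral_mult_right has_integral_power_Beta)
  moreover have "real n * real ((n - 1) choose m) *
      (fact (m + j) * fact (n - 1 - m - j) / fact (m + j + (n - 1 - m - j) + 1)) =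
      (fact (m + j) / fact m) * (fact (n - 1 - m - j) / fact (n - 1 - m))"
  proof -
    obtain l where l: "n = Suc l" "m \<le> l" using assms by (cases n) auto
    have "m + j + (l - m - j) + 1 = Suc l" using assms l by simp
    moreover have "real (l choose m) = fact l / (fact m * fact (l - m))"
      using l(2) by (rule binomial_fact)
    ultimately show ?thesis
      by (simp add: l(1) del: of_nat_Suc)
  qed
  ultimately show ?thesis by (simp add: mult.assoc)
qed

text \<open>Each of the j factors of (m + j)! / m! is at most m + j. In the same way
  \<open>power_le_fact_add\<close> bounds each factor of (d + j)! / d! from below by d + 1. With d =
  n - 1 - m - j the quotient (m + j) / (d + 1) is exactly the odds of (m + j) / n, so the odds
  moment is at most the j-th power of these odds.\<close>

lemma fact_add_le_power: "fact (m + j) \<le> (real (m + j)) ^ j * fact m"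
proof (induction j)
  case (Suc j)
  have "(fact (m + Suc j) :: real) = real (m + Suc j) * fact (m + j)" by simp
  also have "\<dots> \<le> real (m + Suc j) * (real (m + j) ^ j * fact m)"
    by (intro mult_left_mono Suc) auto
  also have "\<dots> \<le> real (m + Suc j) * (real (m + Suc j) ^ j * fact m)"
    by (intro mult_left_mono mult_right_mono power_mono) auto
  finally show ?case by (simp add: mult.assoc)
qed simp

lemma power_le_fact_add: "(real (Suc d)) ^ j * fact d \<le> fact (d + j)"
proof (induction j)
  case (Suc j)
  have "real (Suc d) ^ Suc j * fact d = real (Suc d) * (real (Suc d) ^ j * fact d)" by simp
  also have "\<dots> \<le> real (d + Suc j) * fact (d + j)"
    by (intro mult_mono Suc) auto
  finally show ?case by simp
qed simp

context
  fixes \<alpha> \<beta> :: real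
  assumes \<alpha>: "0 < \<alpha>" and \<beta>: "0 < \<beta>"
begin

lemma has_integral_beta_cdf_kernel:
  assumes "m < n"
  shows "((\<lambda>x. beta_cdf \<alpha> \<beta> x * (real n * real ((n - 1) choose m) * x ^ m * (1 - x) ^ (n - 1 - m)))
           has_integral (\<Sum>k\<le>m. beta_binomial \<alpha> \<beta> n k)) {0..1}"
proof -
  define g :: "real \<Rightarrow> real" where "g x = (\<Sum>k\<le>m. real (n choose k) * x ^ k * (1 - x) ^ (n - k))" for x
  define \<kappa> :: "real \<Rightarrow> real" where "\<kappa> x = real n * real ((n - 1) choose m) * x ^ m * (1 - x) ^ (n - 1 - m)" for x
  have "((\<lambda>x. \<Sum>k\<le>m. beta_density \<alpha> \<beta> x * (real (n choose k) * x ^ k * (1 - x) ^ (n - k)))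
           has_integral (\<Sum>k\<le>m. beta_binomial \<alpha> \<beta> n k)) {0..1}"
    using assms by (intro has_integral_sum has_integral_beta_binomial \<alpha> \<beta>) auto
  then have 1: "((\<lambda>x. beta_density \<alpha> \<beta> x * g x) has_integral (\<Sum>k\<le>m. beta_binomial \<alpha> \<beta> n k)) {0..1}"
    by (simp add: g_def sum_distrib_left)
  have D: "(g has_real_derivative - \<kappa> x) (at x)" for x
    unfolding g_def \<kappa>_def by (rule DERIV_binomial_tail[OF assms])
  have "((\<lambda>x. beta_density \<alpha> \<beta> x * g x - beta_cdf \<alpha> \<beta> x * \<kappa> x) has_integral
      beta_cdf \<alpha> \<beta> 1 * g 1 - beta_cdf \<alpha> \<beta> 0 * g 0) {0..1}"
  proof (rule fundamental_theorem_of_calculus_interior)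
    show "continuous_on {0..1} (\<lambda>x. beta_cdf \<alpha> \<beta> x * g x)"
      by (intro continuous_on_mult continuous_on_beta_cdf \<alpha> \<beta> DERIV_continuous_on[of _ g "\<lambda>x. - \<kappa> x"])
         (auto intro: has_field_derivative_at_within D)
    fix x :: real assume x: "x \<in> {0<..<1}"
    have "((\<lambda>x. beta_cdf \<alpha> \<beta> x * g x) has_real_derivative
        beta_density \<alpha> \<beta> x * g x - beta_cdf \<alpha> \<beta> x * \<kappa> x) (at x)"
      using DERIV_mult[OF DERIV_beta_cdf[OF \<alpha> \<beta>, of x] D[of x]] x by (simp add: algebra_simps)
    then show "((\<lambda>x. beta_cdf \<alpha> \<beta> x * g x) has_vector_derivative
        beta_density \<alpha> \<beta> x * g x - beta_cdf \<alpha> \<beta> x * \<kappa> x) (at x)"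
      by (simp add: has_real_derivative_iff_has_vector_derivative)
  qed simp
  \<comment> \<open>Every summand contains (1 - x)^(n - k) with k \<le> m < n. As
    \<open>beta_cdf\<close> is 0 at 0, both boundary terms of the integration by parts
    vanish.\<close>
  moreover have "g 1 = 0"
    unfolding g_def using assms by (intro sum.neutral) auto
  ultimately have "((\<lambda>x. beta_density \<alpha> \<beta> x * g x - beta_cdf \<alpha> \<beta> x * \<kappa> x) has_integral 0) {0..1}"
    using \<alpha> \<beta> by simp
  from has_integral_diff[OF 1 this] show ?thesis by (simp add: \<kappa>_def)
qed

text \<open>\<open>beta_cdf\<close> is a concave function of the odds \<open>(x / (1 - x)) ^ j\<close>; this is its tangent line at \<open>y\<close>.\<close>

lemma beta_cdf_tangent:
  assumes j: "\<alpha> \<le> real j" "0 < j" and y: "0 < y" "y < 1"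
  obtains c where "0 \<le> c"
    "\<And>x. 0 \<le> x \<Longrightarrow> x < 1 \<Longrightarrow>
       beta_cdf \<alpha> \<beta> x \<le> beta_cdf \<alpha> \<beta> y + c * ((x / (1 - x)) ^ j - (y / (1 - y)) ^ j)"
proof -
  define h :: "real \<Rightarrow> real" where "h x = (x / (1 - x)) ^ j" for x
  define h' :: "real \<Rightarrow> real" where "h' x = real j * x ^ (j - 1) / (1 - x) ^ (j + 1)" for x
  define f where "f = beta_density \<alpha> \<beta>"
  \<comment> \<open>The slope at y of \<open>beta_cdf\<close> regarded as a function of h.\<close>
  define c where "c = f y / h' y"
  define D where "D x = beta_cdf \<alpha> \<beta> x - c * h x" for x
  have h'_pos: "0 < h' x" if "0 < x" "x < 1" for x
    using that j by (simp add: h'_def)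
  have dh: "(h has_real_derivative h' x) (at x)" if "x < 1" for x
  proof -
    have "(h has_real_derivative real j * (x / (1 - x)) ^ (j - 1) * (1 / (1 - x)^2)) (at x)"
    proof -
      have "((\<lambda>x. x / (1 - x)) has_real_derivative 1 / (1 - x)^2) (at x)"
        using that by (auto intro!: derivative_eq_intros simp: power2_eq_square divide_simps)
      from DERIV_power[OF this, of j] show ?thesis
        unfolding h_def by (simp add: mult_ac)
    qed
    also have "real j * (x / (1 - x)) ^ (j - 1) * (1 / (1 - x)^2) = h' x"
    proof -
      have "(1 - x) ^ (j + 1) = (1 - x) ^ (j - 1) * (1 - x) ^ 2"
        using j by (simp flip: power_add)
      then show ?thesis by (simp add: h'_def power_divide)
    qed
    finally show ?thesis .
  qed
  \<comment> \<open>The derivative of \<open>beta_cdf\<close> with respect to h. The exponent of x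
    is at most 0 and that of 1 - x is positive, so it decreases, which is the concavity.\<close>
  have ratio: "f x / h' x = x powr (\<alpha> - real j) * (1 - x) powr (\<beta> + real j) / (real j * Beta \<alpha> \<beta>)"
    if "0 < x" "x < 1" for x
  proof -
    define s t where "s = x ^ (j - 1)" and "t = (1 - x) ^ (j + 1)"
    have pos: "0 < s" "0 < t" using that by (auto simp: s_def t_def)
    have "x powr (\<alpha> - 1) = x powr (\<alpha> - real j) * s"
      using that j unfolding s_def by (simp flip: powr_realpow powr_add add: of_nat_diff)
    moreover have "(1 - x) powr (\<beta> + real j) = (1 - x) powr (\<beta> - 1) * t"
      using that j unfolding t_def by (simp flip: powr_realpow powr_add del: power_Suc add: algebra_simps)
    moreover have "h' x = real j * s / t"
      by (simp add: h'_def s_def t_def)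
    ultimately show ?thesis
      using that j pos by (simp add: f_def beta_density_def)
  qed
  have ratio_antimono: "f x / h' x \<ge> f x' / h' x'" if "0 < x" "x \<le> x'" "x' < 1" for x x'
  proof -
    have "x' powr (\<alpha> - real j) \<le> x powr (\<alpha> - real j)"
      using that j by (intro powr_mono2') auto
    moreover have "(1 - x') powr (\<beta> + real j) \<le> (1 - x) powr (\<beta> + real j)"
      using that j \<beta> by (intro powr_mono2) auto
    ultimately show ?thesis
      using that Beta_real_pos[OF \<alpha> \<beta>] j
      by (subst (1 2) ratio) (auto intro!: divide_right_mono mult_mono)
  qed
  have dD: "(D has_real_derivative (f x / h' x - c) * h' x) (at x)" if "0 < x" "x < 1" for x
    unfolding D_def using DERIV_diff[OF DERIV_beta_cdf[OF \<alpha> \<beta> that] DERIV_cmult[OF dh, of x c]] that h'_pos[OF that]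
    by (simp add: f_def left_diff_distrib)
  have contD: "continuous_on {0..b} D" if "b < 1" for b
    unfolding D_def using that
    by (intro continuous_intros continuous_on_beta_cdf \<alpha> \<beta> DERIV_continuous_on[of _ h h'])
       (auto intro!: has_field_derivative_at_within dh)
  \<comment> \<open>f / h' - c changes from nonnegative to nonpositive at y, so D rises up to y and
    falls afterwards.\<close>
  have le: "D x \<le> D y" if "0 \<le> x" "x < 1" for x
  proof (cases x y rule: linorder_cases)
    case less
    show ?thesis
    proof (rule DERIV_nonneg_imp_increasing_open[OF less_imp_le[OF less]])
      fix t assume "x < t" "t < y"
      with that y show "\<exists>z. (D has_real_derivative z) (at t) \<and> 0 \<le> z"
        by (intro exI[of _ "(f t / h' t - c) * h' t"] conjI dD mult_nonneg_nonneg less_imp_le[OF h'_pos])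
           (auto simp: c_def intro!: ratio_antimono)
    qed (use that y in \<open>auto intro: continuous_on_subset[OF contD[of y]]\<close>)
  next
    case greater
    show ?thesis
    proof (rule DERIV_nonpos_imp_decreasing_open[OF less_imp_le[OF greater]])
      fix t assume "y < t" "t < x"
      with that y show "\<exists>z. (D has_real_derivative z) (at t) \<and> z \<le> 0"
        by (intro exI[of _ "(f t / h' t - c) * h' t"] conjI dD mult_nonpos_nonneg less_imp_le[OF h'_pos])
           (auto simp: c_def intro!: ratio_antimono)
    qed (use that y in \<open>auto intro: continuous_on_subset[OF contD[of x]]\<close>)
  qed simp
  show thesis
  proof (rule that[of c])
    show "0 \<le> c"
      unfolding c_def f_def using h'_pos[OF y] by (simp add: beta_density_nonneg[OF \<alpha> \<beta>])
    fix x :: real assume "0 \<le> x" "x < 1"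
    then show "beta_cdf \<alpha> \<beta> x \<le> beta_cdf \<alpha> \<beta> y + c * ((x / (1 - x)) ^ j - (y / (1 - y)) ^ j)"
      using le[of x] unfolding D_def h_def by (simp add: algebra_simps)
  qed
qed

lemma beta_binomial_cdf_le:
  assumes j: "\<alpha> \<le> real j" "0 < j" and mn: "m + j < n"
  shows "(\<Sum>k\<le>m. beta_binomial \<alpha> \<beta> n k) \<le> beta_cdf \<alpha> \<beta> (real (m + j) / real n)"
proof -
  define y where "y = real (m + j) / real n"
  have y: "0 < y" "y < 1" using j mn by (auto simp: y_def simp flip: of_nat_add)
  obtain c where c: "0 \<le> c" and tangent: "\<And>x. 0 \<le> x \<Longrightarrow> x < 1 \<Longrightarrow>
       beta_cdf \<alpha> \<beta> x \<le> beta_cdf \<alpha> \<beta> y + c * ((x / (1 - x)) ^ j - (y / (1 - y)) ^ j)"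
    using beta_cdf_tangent[OF j y] by blast
  define \<kappa> :: "real \<Rightarrow> real" where "\<kappa> x = real n * real ((n - 1) choose m) * x ^ m * (1 - x) ^ (n - 1 - m)" for x
  define \<mu> :: "real \<Rightarrow> real" where "\<mu> x = real n * real ((n - 1) choose m) * x ^ (m + j) * (1 - x) ^ (n - 1 - m - j)" for x
  define I :: real where "I = (fact (m + j) / fact m) * (fact (n - 1 - m - j) / fact (n - 1 - m))"
  \<comment> \<open>Intercept of the tangent line in the variable (x / (1 - x))^j. Integrating the
    line against the kernel replaces this variable by its moment I.\<close>
  define B where "B = beta_cdf \<alpha> \<beta> y - c * (y / (1 - y)) ^ j"
  have "(\<Sum>k\<le>m. beta_binomial \<alpha> \<beta> n k) \<le> B * 1 + c * I"
  proof (rule has_integral_le)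
    show "((\<lambda>x. beta_cdf \<alpha> \<beta> x * \<kappa> x) has_integral (\<Sum>k\<le>m. beta_binomial \<alpha> \<beta> n k)) {0..1}"
      unfolding \<kappa>_def using mn by (intro has_integral_beta_cdf_kernel) auto
    have "(\<kappa> has_integral 1) {0..1}"
      unfolding \<kappa>_def using has_integral_binomial_kernel[of m 0 n] mn by simp
    moreover have "(\<mu> has_integral I) {0..1}"
      unfolding \<mu>_def I_def by (intro has_integral_binomial_kernel mn)
    ultimately show "((\<lambda>x. B * \<kappa> x + c * \<mu> x) has_integral (B * 1 + c * I)) {0..1}"
      by (intro has_integral_add has_integral_mult_right)
    fix x :: real assume x: "x \<in> {0..1}"
    show "beta_cdf \<alpha> \<beta> x * \<kappa> x \<le> B * \<kappa> x + c * \<mu> x"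
    \<comment> \<open>The tangent bound stops short of x = 1. There the kernel \<kappa> is 0,
      because j > 0 and m + j < n, and c times \<mu> is nonnegative.\<close>
    proof (cases "x = 1")
      case True
      then show ?thesis using c mn j by (auto simp: \<kappa>_def \<mu>_def zero_power)
    next
      case False
      with x have x1: "0 \<le> x" "x < 1" by auto
      have "(1 - x) ^ (n - 1 - m) = (1 - x) ^ (n - 1 - m - j) * (1 - x) ^ j"
        using mn by (simp flip: power_add)
      then have *: "(x / (1 - x)) ^ j * \<kappa> x = \<mu> x"
        using x1 by (simp add: \<kappa>_def \<mu>_def power_divide power_add)
      have "beta_cdf \<alpha> \<beta> x \<le> B + c * (x / (1 - x)) ^ j"
        using tangent[OF x1] by (simp add: B_def algebra_simps)
      then have "beta_cdf \<alpha> \<beta> x * \<kappa> x \<le> (B + c * (x / (1 - x)) ^ j) * \<kappa> x"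
        using x1 by (intro mult_right_mono) (auto simp: \<kappa>_def)
      also have "\<dots> = B * \<kappa> x + c * ((x / (1 - x)) ^ j * \<kappa> x)" by (simp add: algebra_simps)
      finally show ?thesis unfolding * .
    qed
  qed
  moreover have "I \<le> (y / (1 - y)) ^ j"
  proof -
    define d where "d = n - 1 - m - j"
    have d: "n - 1 - m = d + j" "real n = real (m + j) + real (Suc d)"
      using mn by (auto simp: d_def)
    have "1 - y = real (Suc d) / real n"
      using mn d(2) unfolding y_def by (simp add: field_simps)
    then have odds: "y / (1 - y) = real (m + j) / real (Suc d)"
      using mn unfolding y_def by simp
    have "(fact (m + j) / fact m :: real) \<le> real (m + j) ^ j"
      using fact_add_le_power[of m j] by (simp add: field_simps)
    moreover have "(fact d / fact (d + j) :: real) \<le> 1 / real (Suc d) ^ j"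
      using power_le_fact_add[of d j] by (simp add: field_simps)
    ultimately have "I \<le> real (m + j) ^ j * (1 / real (Suc d) ^ j)"
      unfolding I_def d_def[symmetric] d(1) by (intro mult_mono) auto
    then show ?thesis unfolding odds by (simp add: power_divide)
  qed
  then have "c * I \<le> c * (y / (1 - y)) ^ j" using c by (rule mult_left_mono)
  ultimately show ?thesis unfolding B_def y_def by simp
qed

end

lemma beta_binomial_cdf_ge:
  assumes "0 < \<alpha>" "0 < \<beta>" and j: "\<beta> \<le> real j" "0 < j" and jn: "j \<le> Suc m" and mn: "m < n"
  shows "beta_cdf \<alpha> \<beta> ((real (Suc m) - real j) / real n) \<le> (\<Sum>k\<le>m. beta_binomial \<alpha> \<beta> n k)"
\<comment> \<open>For j = \<open>Suc m\<close> the argument on the left is 0 and the bound is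
  trivial, while the complementary count would satisfy m' + j = n, just outside the range of
  \<open>beta_binomial_cdf_le\<close>.\<close>
proof (cases "j = Suc m")
  case True
  then show ?thesis using assms by (simp add: sum_nonneg beta_binomial_nonneg)
next
  case False
  \<comment> \<open>More than m draws of the first colour means at most n - m - 1 draws of the
    second.\<close>
  define m' where "m' = n - Suc m"
  have m': "m' + j < n" using False jn mn by (auto simp: m'_def)
  have "(\<Sum>k\<le>m'. beta_binomial \<beta> \<alpha> n k) \<le> beta_cdf \<beta> \<alpha> (real (m' + j) / real n)"
    by (intro beta_binomial_cdf_le assms m')
  also have "(\<Sum>k\<le>m'. beta_binomial \<beta> \<alpha> n k) = (\<Sum>k\<in>{Suc m..n}. beta_binomial \<alpha> \<beta> n k)"
    using mn beta_binomial_commute[of _ n \<beta> \<alpha>]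
    by (intro sum.reindex_bij_witness[of _ "\<lambda>k. n - k" "\<lambda>k. n - k"]) (auto simp: m'_def)
  also have "\<dots> = 1 - (\<Sum>k\<le>m. beta_binomial \<alpha> \<beta> n k)"
  proof -
    have "{..n} = {..m} \<union> {Suc m..n}" using mn by auto
    then have "(\<Sum>k\<le>n. beta_binomial \<alpha> \<beta> n k) = (\<Sum>k\<le>m. beta_binomial \<alpha> \<beta> n k) + (\<Sum>k\<in>{Suc m..n}. beta_binomial \<alpha> \<beta> n k)"
      by (simp add: sum.union_disjoint)
    then show ?thesis using sum_beta_binomial[of \<alpha> \<beta> n] assms by simp
  qed
  also have "beta_cdf \<beta> \<alpha> (real (m' + j) / real n) = 1 - beta_cdf \<alpha> \<beta> (1 - real (m' + j) / real n)"
    using m' assms by (subst beta_cdf_commute) (auto simp flip: of_nat_add)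
  also have "1 - real (m' + j) / real n = (real (Suc m) - real j) / real n"
    using mn by (simp add: m'_def field_simps of_nat_diff)
  finally show ?thesis by simp
qed

section \<open>Monotone rearrangement of a beta variable to beta-binomial counts\<close>

text \<open>If \<open>B\<close> is beta distributed, then \<open>beta_binomial_quantile \<alpha> \<beta> n B\<close> is its monotone rearrangement
  to the beta-binomial law.\<close>

definition beta_binomial_quantile :: "real \<Rightarrow> real \<Rightarrow> nat \<Rightarrow> real \<Rightarrow> nat" where
  "beta_binomial_quantile \<alpha> \<beta> n b = (LEAST m. beta_cdf \<alpha> \<beta> b \<le> (\<Sum>k\<le>m. beta_binomial \<alpha> \<beta> n k))"

context
  fixes \<alpha> \<beta> :: real
  assumes \<alpha>: "0 < \<alpha>" and \<beta>: "0 < \<beta>"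
begin

lemma beta_binomial_quantile_measurable [measurable]:
  "beta_binomial_quantile \<alpha> \<beta> n \<in> borel \<rightarrow>\<^sub>M count_space UNIV"
proof -
  note beta_cdf_measurable[OF \<alpha> \<beta>, measurable]
  show ?thesis unfolding beta_binomial_quantile_def[abs_def] by measurable
qed

lemma beta_cdf_le_sum_beta_binomial: "b \<le> 1 \<Longrightarrow> beta_cdf \<alpha> \<beta> b \<le> (\<Sum>k\<le>n. beta_binomial \<alpha> \<beta> n k)"
  using monoD[OF mono_beta_cdf[OF \<alpha> \<beta>], of b 1] \<alpha> \<beta> by (simp add: sum_beta_binomial)

lemma beta_binomial_quantile_le: "b \<le> 1 \<Longrightarrow> beta_binomial_quantile \<alpha> \<beta> n b \<le> n"
  unfolding beta_binomial_quantile_def by (intro Least_le beta_cdf_le_sum_beta_binomial)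

text \<open>Galois connection between the quantile and the discrete distribution function. For b
  \<le> 1 the value n qualifies, since the full sum is 1, so the \<open>LEAST\<close> is
  attained.\<close>

lemma beta_binomial_quantile_le_iff:
  assumes "b \<le> 1"
  shows "beta_binomial_quantile \<alpha> \<beta> n b \<le> m \<longleftrightarrow> beta_cdf \<alpha> \<beta> b \<le> (\<Sum>k\<le>m. beta_binomial \<alpha> \<beta> n k)"
proof
  assume *: "beta_binomial_quantile \<alpha> \<beta> n b \<le> m"
  have "beta_cdf \<alpha> \<beta> b \<le> (\<Sum>k\<le>beta_binomial_quantile \<alpha> \<beta> n b. beta_binomial \<alpha> \<beta> n k)"
    using beta_cdf_le_sum_beta_binomial[OF assms] unfolding beta_binomial_quantile_def by (rule LeastI)
  also have "\<dots> \<le> (\<Sum>k\<le>m. beta_binomial \<alpha> \<beta> n k)"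
    using * by (intro sum_mono2 beta_binomial_nonneg \<alpha> \<beta>) auto
  finally show "beta_cdf \<alpha> \<beta> b \<le> (\<Sum>k\<le>m. beta_binomial \<alpha> \<beta> n k)" .
qed (simp add: beta_binomial_quantile_def Least_le)

text \<open>At the quantile q the discrete distribution function has reached F b, at q - 1 it has
  not. The upper comparison at q and the lower one at q - 1, with monotonicity of F, give n b \<le>
  q + j and q - j \<le> n b. Outside the range of the comparisons, 0 < b < 1 suffices.\<close>

lemma beta_binomial_quantile_close:
  assumes j: "\<alpha> \<le> real j" "\<beta> \<le> real j" "0 < j" and b: "0 < b" "b < 1"
  shows "\<bar>real (beta_binomial_quantile \<alpha> \<beta> n b) - real n * b\<bar> \<le> real j"
proof -
  define q where "q = beta_binomial_quantile \<alpha> \<beta> n b"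
  have qn: "q \<le> n" using beta_binomial_quantile_le b by (simp add: q_def)
  have "real n * b \<le> real (q + j)"
  proof (cases "q + j < n")
    case True
    have "beta_cdf \<alpha> \<beta> b \<le> (\<Sum>k\<le>q. beta_binomial \<alpha> \<beta> n k)"
      using beta_binomial_quantile_le_iff[of b n q] b by (simp add: q_def)
    also have "\<dots> \<le> beta_cdf \<alpha> \<beta> (real (q + j) / real n)"
      by (intro beta_binomial_cdf_le \<alpha> \<beta> j True)
    finally have "\<not> real (q + j) / real n < b"
      using beta_cdf_strict_mono[OF \<alpha> \<beta>, of "real (q + j) / real n" b] b by auto
    then show ?thesis using True by (simp add: field_simps)
  next
    case False
    have "real n * b \<le> real n" using b by (simp add: mult_left_le)
    also have "\<dots> \<le> real (q + j)" using False by (simp flip: of_nat_add)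
    finally show ?thesis .
  qed
  moreover have "real q - real j \<le> real n * b"
  proof (cases "j < q")
    case True
    then obtain m where m: "q = Suc m" by (cases q) auto
    have "beta_cdf \<alpha> \<beta> ((real (Suc m) - real j) / real n) \<le> (\<Sum>k\<le>m. beta_binomial \<alpha> \<beta> n k)"
      using True m qn by (intro beta_binomial_cdf_ge \<alpha> \<beta> j) auto
    also have "\<dots> < beta_cdf \<alpha> \<beta> b"
      using beta_binomial_quantile_le_iff[of b n m] b m by (auto simp: q_def)
    finally have "\<not> b \<le> (real q - real j) / real n"
      using monoD[OF mono_beta_cdf[OF \<alpha> \<beta>], of b "(real q - real j) / real n"] m by auto
    then show ?thesis using True qn by (simp add: field_simps)
  next
    case False
    moreover have "0 \<le> real n * b" using b by simp
    ultimately show ?thesis by linarith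
  qed
  ultimately show ?thesis unfolding q_def by linarith
qed

lemma nn_integral_beta_density:
  assumes "0 \<le> u" "u \<le> 1"
  shows "(\<integral>\<^sup>+b. ennreal (beta_density \<alpha> \<beta> b) * indicator {..u} b \<partial>lborel) = ennreal (beta_cdf \<alpha> \<beta> u)"
proof -
  have "(beta_density \<alpha> \<beta> has_integral beta_cdf \<alpha> \<beta> u) {0..u}"
    unfolding beta_cdf_def by (intro integrable_integral beta_density_integrable \<alpha> \<beta>)
  then have "(\<integral>\<^sup>+b. ennreal (beta_density \<alpha> \<beta> b) * indicator {0..u} b \<partial>lborel) = ennreal (beta_cdf \<alpha> \<beta> u)"
    using nn_integral_has_integral_lebesgue[of "{0..u}" "beta_density \<alpha> \<beta>", OF beta_density_nonneg[OF \<alpha> \<beta>]]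
    by (simp add: mult_ac ennreal_mult'' ennreal_indicator)
  also have "(\<integral>\<^sup>+b. ennreal (beta_density \<alpha> \<beta> b) * indicator {0..u} b \<partial>lborel) =
      (\<integral>\<^sup>+b. ennreal (beta_density \<alpha> \<beta> b) * indicator {..u} b \<partial>lborel)"
    by (intro nn_integral_cong) (auto simp: beta_density_def indicator_def)
  finally show ?thesis .
qed

text \<open>F is continuous and onto [0, 1], so some u satisfies F u = G for the partial sum G. As F
  is strictly increasing, inside (0, 1) the event is just b \<le> u.\<close>

lemma nn_integral_beta_quantile_le:
  assumes "m \<le> n"
  shows "(\<integral>\<^sup>+b. ennreal (beta_density \<alpha> \<beta> b) * indicator {b. beta_binomial_quantile \<alpha> \<beta> n b \<le> m} b \<partial>lborel)
    = ennreal (\<Sum>k\<le>m. beta_binomial \<alpha> \<beta> n k)"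
proof -
  let ?G = "\<Sum>k\<le>m. beta_binomial \<alpha> \<beta> n k"
  have "?G \<le> (\<Sum>k\<le>n. beta_binomial \<alpha> \<beta> n k)"
    using assms by (intro sum_mono2 beta_binomial_nonneg \<alpha> \<beta>) auto
  then have "0 \<le> ?G" "?G \<le> 1"
    using \<alpha> \<beta> by (auto simp: sum_beta_binomial intro!: sum_nonneg beta_binomial_nonneg)
  then obtain u where u: "0 \<le> u" "u \<le> 1" "beta_cdf \<alpha> \<beta> u = ?G"
    using beta_cdf_onto[OF \<alpha> \<beta>] by blast
  have "beta_binomial_quantile \<alpha> \<beta> n b \<le> m \<longleftrightarrow> b \<le> u" if "0 < b" "b < 1" for b
    using that u beta_binomial_quantile_le_iff[of b n m] beta_cdf_strict_mono[OF \<alpha> \<beta>, of u b]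
      monoD[OF mono_beta_cdf[OF \<alpha> \<beta>], of b u] by force
  then have "(\<integral>\<^sup>+b. ennreal (beta_density \<alpha> \<beta> b) * indicator {b. beta_binomial_quantile \<alpha> \<beta> n b \<le> m} b \<partial>lborel)
     = (\<integral>\<^sup>+b. ennreal (beta_density \<alpha> \<beta> b) * indicator {..u} b \<partial>lborel)"
    by (intro nn_integral_cong) (auto simp: beta_density_def indicator_def)
  then show ?thesis using nn_integral_beta_density[OF u(1,2)] u(3) by simp
qed

lemma nn_integral_beta_quantile_eq:
  assumes "m \<le> n"
  shows "(\<integral>\<^sup>+b. ennreal (beta_density \<alpha> \<beta> b) * indicator {b. beta_binomial_quantile \<alpha> \<beta> n b = m} b \<partial>lborel)
    = ennreal (beta_binomial \<alpha> \<beta> n m)"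
proof (cases m)
  case 0
  then show ?thesis using nn_integral_beta_quantile_le[of 0 n] by simp
next
  case (Suc l)
  let ?q = "beta_binomial_quantile \<alpha> \<beta> n"
  let ?G = "\<Sum>k\<le>l. beta_binomial \<alpha> \<beta> n k"
  let ?I = "\<integral>\<^sup>+b. ennreal (beta_density \<alpha> \<beta> b) * indicator {b. ?q b = m} b \<partial>lborel"
  have G: "0 \<le> ?G" by (intro sum_nonneg beta_binomial_nonneg \<alpha> \<beta>)
  have "ennreal ?G + ennreal (beta_binomial \<alpha> \<beta> n m) = ennreal (\<Sum>k\<le>m. beta_binomial \<alpha> \<beta> n k)"
    using G \<alpha> \<beta> by (simp add: Suc beta_binomial_nonneg flip: ennreal_plus)
  also have "\<dots> = (\<integral>\<^sup>+b. ennreal (beta_density \<alpha> \<beta> b) * indicator {b. ?q b \<le> m} b \<partial>lborel)"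
    using nn_integral_beta_quantile_le[OF assms] by simp
  also have "\<dots> = (\<integral>\<^sup>+b. ennreal (beta_density \<alpha> \<beta> b) * indicator {b. ?q b \<le> l} b
       + ennreal (beta_density \<alpha> \<beta> b) * indicator {b. ?q b = m} b \<partial>lborel)"
    by (intro nn_integral_cong) (auto simp: Suc indicator_def)
  also have "\<dots> = (\<integral>\<^sup>+b. ennreal (beta_density \<alpha> \<beta> b) * indicator {b. ?q b \<le> l} b \<partial>lborel) + ?I"
    by (intro nn_integral_add) measurable
  also have "(\<integral>\<^sup>+b. ennreal (beta_density \<alpha> \<beta> b) * indicator {b. ?q b \<le> l} b \<partial>lborel) = ennreal ?G"
    using assms Suc by (intro nn_integral_beta_quantile_le) auto
  finally show ?thesis
    by (simp add: ennreal_add_left_cancel)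
qed

end

section \<open>Stick breaking\<close>

interpretation lborel_product: product_sigma_finite "\<lambda>_. lborel :: real measure"
  by unfold_locales

text \<open>One affine substitution per coordinate, glued by Fubini. The power of c is the Jacobian
  needed when the remaining stick is rescaled to length 1.\<close>

lemma nn_integral_PiM_lborel_scale:
  fixes f :: "('i \<Rightarrow> real) \<Rightarrow> ennreal" and c :: real
  assumes "finite T" "0 < c" and "f \<in> borel_measurable (\<Pi>\<^sub>M i\<in>T. lborel)"
  shows "(\<integral>\<^sup>+y. f y \<partial>(\<Pi>\<^sub>M i\<in>T. lborel)) =
     ennreal (c ^ card T) * (\<integral>\<^sup>+y. f (\<lambda>i\<in>T. c * y i) \<partial>(\<Pi>\<^sub>M i\<in>T. lborel))"
  using assms(1,3)
proof (induction T arbitrary: f rule: finite_induct)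
  case empty
  then show ?case by (simp add: lborel_product.nn_integral_empty restrict_def space_PiM_empty)
next
  case (insert i T)
  note insert.prems[measurable]
  have upd[measurable]: "(\<lambda>p. (snd p)(i := fst p)) \<in> lborel \<Otimes>\<^sub>M (\<Pi>\<^sub>M i\<in>T. lborel) \<rightarrow>\<^sub>M (\<Pi>\<^sub>M i\<in>insert i T. lborel)"
    by (rule measurable_fun_upd[of _ T]) auto
  have upd'[measurable]: "(\<lambda>p. (\<lambda>k\<in>T. c * snd p k)(i := fst p)) \<in> lborel \<Otimes>\<^sub>M (\<Pi>\<^sub>M i\<in>T. lborel) \<rightarrow>\<^sub>M (\<Pi>\<^sub>M i\<in>insert i T. lborel)"
    by (rule measurable_fun_upd[of _ T]) auto
  have m1: "(\<lambda>x. f (x(i := y))) \<in> borel_measurable (\<Pi>\<^sub>M i\<in>T. lborel)" for y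
    by (rule measurable_compose[OF _ insert.prems], rule measurable_fun_upd[of _ T]) auto
  have m2: "(\<lambda>y. \<integral>\<^sup>+x. f ((\<lambda>k\<in>T. c * x k)(i := y)) \<partial>(\<Pi>\<^sub>M i\<in>T. lborel)) \<in> borel_measurable borel"
  proof -
    have "(\<lambda>p. f ((\<lambda>k\<in>T. c * snd p k)(i := fst p))) \<in> borel_measurable (lborel \<Otimes>\<^sub>M (\<Pi>\<^sub>M i\<in>T. lborel))"
      by (rule measurable_compose[OF upd' insert.prems])
    then have "(\<lambda>y. \<integral>\<^sup>+x. f ((\<lambda>k\<in>T. c * x k)(i := y)) \<partial>(\<Pi>\<^sub>M i\<in>T. lborel)) \<in> borel_measurable lborel"
      by (intro sigma_finite_measure.borel_measurable_nn_integral lborel_product.sigma_finite insert.hyps)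
         (simp add: case_prod_beta)
    then show ?thesis by simp
  qed
  let ?R = "\<lambda>x. \<lambda>k\<in>insert i T. c * x k"
  have m3: "(\<lambda>x. f (?R x)) \<in> borel_measurable (\<Pi>\<^sub>M i\<in>insert i T. lborel)"
    by (rule measurable_compose[OF _ insert.prems]) measurable
  have "(\<integral>\<^sup>+y. f y \<partial>(\<Pi>\<^sub>M i\<in>insert i T. lborel)) = (\<integral>\<^sup>+y. (\<integral>\<^sup>+x. f (x(i := y)) \<partial>(\<Pi>\<^sub>M i\<in>T. lborel)) \<partial>lborel)"
    by (intro lborel_product.product_nn_integral_insert_rev insert)
  also have "\<dots> = (\<integral>\<^sup>+y. ennreal (c ^ card T) * (\<integral>\<^sup>+x. f ((\<lambda>k\<in>T. c * x k)(i := y)) \<partial>(\<Pi>\<^sub>M i\<in>T. lborel)) \<partial>lborel)"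
    by (intro nn_integral_cong insert.IH m1)
  also have "\<dots> = ennreal (c ^ card T) * (\<integral>\<^sup>+y. (\<integral>\<^sup>+x. f ((\<lambda>k\<in>T. c * x k)(i := y)) \<partial>(\<Pi>\<^sub>M i\<in>T. lborel)) \<partial>lborel)"
    using m2 by (intro nn_integral_cmult) simp
  also have "\<dots> = ennreal (c ^ card T) * (ennreal c * (\<integral>\<^sup>+y. (\<integral>\<^sup>+x. f ((\<lambda>k\<in>T. c * x k)(i := c * y)) \<partial>(\<Pi>\<^sub>M i\<in>T. lborel)) \<partial>lborel))"
    using nn_integral_real_affine[OF m2, of c 0] \<open>0 < c\<close> by simp
  also have "(\<integral>\<^sup>+y. (\<integral>\<^sup>+x. f ((\<lambda>k\<in>T. c * x k)(i := c * y)) \<partial>(\<Pi>\<^sub>M i\<in>T. lborel)) \<partial>lborel) =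
      (\<integral>\<^sup>+y. (\<integral>\<^sup>+x. f (?R (x(i := y))) \<partial>(\<Pi>\<^sub>M i\<in>T. lborel)) \<partial>lborel)"
    using insert.hyps(2) by (intro nn_integral_cong arg_cong[where f=f]) (auto simp: fun_eq_iff restrict_def)
  also have "\<dots> = (\<integral>\<^sup>+x. f (?R x) \<partial>(\<Pi>\<^sub>M i\<in>insert i T. lborel))"
    by (intro lborel_product.product_nn_integral_insert_rev[symmetric] insert m3)
  finally have "(\<integral>\<^sup>+y. f y \<partial>(\<Pi>\<^sub>M i\<in>insert i T. lborel)) =
      ennreal (c ^ card T) * (ennreal c * (\<integral>\<^sup>+x. f (?R x) \<partial>(\<Pi>\<^sub>M i\<in>insert i T. lborel)))" .
  moreover have "ennreal (c ^ card (insert i T)) = ennreal (c ^ card T) * ennreal c"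
    using insert.hyps \<open>0 < c\<close> by (simp add: ennreal_mult mult_ac)
  ultimately show ?case by (simp only: mult.assoc)
qed

text \<open>The Dirichlet density in the coordinates \<open>T\<close>; the omitted coordinate has parameter \<open>\<gamma>\<close>.\<close>

definition simplex_density :: "('i \<Rightarrow> real) \<Rightarrow> real \<Rightarrow> 'i set \<Rightarrow> ('i \<Rightarrow> real) \<Rightarrow> real" where
  "simplex_density \<alpha> \<gamma> T y =
     (if (\<forall>i\<in>T. 0 < y i) \<and> sum y T < 1
      then Gamma (sum \<alpha> T + \<gamma>) / ((\<Prod>i\<in>T. Gamma (\<alpha> i)) * Gamma \<gamma>)
             * ((\<Prod>i\<in>T. y i powr (\<alpha> i - 1)) * (1 - sum y T) powr (\<gamma> - 1))
      else 0)"

text \<open>The colour left out of T has parameter \<gamma> and receives the remaining n - sum m T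
  draws. Natural subtraction truncates, so this is the intended probability only for sum m T \<le>
  n, the range in which \<open>dirichlet_multinomial_coupling\<close> asserts the law.\<close>

definition dirichlet_multinomial :: "('i \<Rightarrow> real) \<Rightarrow> real \<Rightarrow> 'i set \<Rightarrow> nat \<Rightarrow> ('i \<Rightarrow> nat) \<Rightarrow> real" where
  "dirichlet_multinomial \<alpha> \<gamma> T n m =
     (\<Prod>i\<in>T. polya_weight (\<alpha> i) (m i)) * polya_weight \<gamma> (n - sum m T) / polya_weight (sum \<alpha> T + \<gamma>) n"

lemma simplex_density_measurable [measurable]:
  "finite T \<Longrightarrow> simplex_density \<alpha> \<gamma> T \<in> borel_measurable (\<Pi>\<^sub>M i\<in>T. lborel)"
  unfolding simplex_density_def[abs_def] by measurable

lemma sum_params_pos: "(\<And>i. i \<in> T \<Longrightarrow> 0 < \<alpha> i) \<Longrightarrow> 0 < \<gamma> \<Longrightarrow> 0 < sum \<alpha> T + (\<gamma>::real)"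
  by (intro add_nonneg_pos sum_nonneg) (auto simp: less_imp_le)

lemma simplex_density_nonneg:
  assumes "\<And>i. i \<in> T \<Longrightarrow> 0 < \<alpha> i" "0 < \<gamma>"
  shows "0 \<le> simplex_density \<alpha> \<gamma> T y"
  unfolding simplex_density_def using assms sum_params_pos[of T \<alpha> \<gamma>]
  by (auto intro!: mult_nonneg_nonneg divide_nonneg_nonneg prod_nonneg simp: less_imp_le)

text \<open>The powers of 1 - b collect: \<open>card T\<close> from the Jacobian, \<alpha> i - 1
  from each coordinate in T, and \<gamma> - 1 from the omitted one. Their total, sum \<alpha> T +
  \<gamma> - 1, is the second exponent of the beta density.\<close>

lemma simplex_density_insert:
  assumes T: "finite T" "j \<notin> T" and \<alpha>: "\<And>i. i \<in> T \<Longrightarrow> 0 < \<alpha> i" "0 < \<alpha> j" and \<gamma>: "0 < \<gamma>"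
    and b: "0 < b" "b < 1"
  shows "(1 - b) ^ card T * simplex_density \<alpha> \<gamma> (insert j T) ((\<lambda>i\<in>T. (1 - b) * z i)(j := b)) =
     beta_density (\<alpha> j) (sum \<alpha> T + \<gamma>) b * simplex_density \<alpha> \<gamma> T z"
proof -
  define y where "y = (\<lambda>i\<in>T. (1 - b) * z i)(j := b)"
  have y: "y j = b" "\<And>i. i \<in> T \<Longrightarrow> y i = (1 - b) * z i"
    using T by (auto simp: y_def)
  have sumy: "sum y T = (1 - b) * sum z T"
    by (simp add: y(2) sum_distrib_left)
  have "1 - sum y (insert j T) = (1 - b) * (1 - sum z T)"
    using T by (simp add: sumy y(1) algebra_simps)
  note sumy' = this
  have cond: "((\<forall>i\<in>insert j T. 0 < y i) \<and> sum y (insert j T) < 1) \<longleftrightarrow> ((\<forall>i\<in>T. 0 < z i) \<and> sum z T < 1)"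
  proof -
    have "sum y (insert j T) < 1 \<longleftrightarrow> 0 < (1 - b) * (1 - sum z T)"
      unfolding sumy'[symmetric] by simp
    then show ?thesis using b by (auto simp: y zero_less_mult_iff)
  qed
  show ?thesis
  proof (cases "(\<forall>i\<in>T. 0 < z i) \<and> sum z T < 1")
    case False
    then show ?thesis
      using cond unfolding y_def[symmetric] by (auto simp: simplex_density_def)
  next
    case True
    define A where "A = sum \<alpha> T + \<gamma>"
    have A: "0 < A" unfolding A_def using \<alpha> \<gamma> by (intro sum_params_pos) auto
    have "(\<Prod>i\<in>T. y i powr (\<alpha> i - 1)) = (\<Prod>i\<in>T. (1 - b) powr (\<alpha> i - 1) * z i powr (\<alpha> i - 1))"
      using b True by (intro prod.cong) (auto simp: y powr_mult less_imp_le)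
    also have "\<dots> = (1 - b) powr (sum \<alpha> T - real (card T)) * (\<Prod>i\<in>T. z i powr (\<alpha> i - 1))"
      using b by (simp add: prod.distrib sum_subtractf flip: powr_sum)
    finally have 1: "(\<Prod>i\<in>T. y i powr (\<alpha> i - 1)) = \<dots>" .
    have 2: "(1 - sum y (insert j T)) powr (\<gamma> - 1) = (1 - b) powr (\<gamma> - 1) * (1 - sum z T) powr (\<gamma> - 1)"
      unfolding sumy' by (rule powr_mult)
    have "(1 - b) ^ card T * (1 - b) powr (sum \<alpha> T - real (card T)) * (1 - b) powr (\<gamma> - 1) = (1 - b) powr (A - 1)"
      using b by (simp add: A_def add_diff_eq flip: powr_realpow powr_add)
    note 3 = this[symmetric]
    have "simplex_density \<alpha> \<gamma> (insert j T) y = Gamma (\<alpha> j + A) / (Gamma (\<alpha> j) * (\<Prod>i\<in>T. Gamma (\<alpha> i)) * Gamma \<gamma>)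
        * (b powr (\<alpha> j - 1) * (\<Prod>i\<in>T. y i powr (\<alpha> i - 1)) * (1 - sum y (insert j T)) powr (\<gamma> - 1))"
      unfolding simplex_density_def using cond True T y(1) by (simp add: A_def add.assoc mult.assoc)
    moreover have "beta_density (\<alpha> j) A b = Gamma (\<alpha> j + A) / (Gamma (\<alpha> j) * Gamma A) * (b powr (\<alpha> j - 1) * (1 - b) powr (A - 1))"
      using b by (simp add: beta_density_def Beta_def)
    moreover have "simplex_density \<alpha> \<gamma> T z = Gamma A / ((\<Prod>i\<in>T. Gamma (\<alpha> i)) * Gamma \<gamma>)
        * ((\<Prod>i\<in>T. z i powr (\<alpha> i - 1)) * (1 - sum z T) powr (\<gamma> - 1))"
      using True by (simp add: simplex_density_def A_def)
    ultimately show ?thesis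
      unfolding y_def[symmetric] A_def[symmetric] using Gamma_real_pos[OF A] by (simp add: 1 2 3 mult_ac)
  qed
qed

text \<open>Stick breaking: the coordinate \<open>j\<close> is beta distributed and independent of the remaining
  coordinates divided by \<open>1 - y j\<close>, which are again Dirichlet distributed.\<close>

lemma nn_integral_simplex_density_insert:
  fixes G :: "real \<Rightarrow> ('i \<Rightarrow> real) \<Rightarrow> ennreal"
  assumes T: "finite T" "j \<notin> T" and \<alpha>: "\<And>i. i \<in> T \<Longrightarrow> 0 < \<alpha> i" "0 < \<alpha> j" and \<gamma>: "0 < \<gamma>"
    and G: "(\<lambda>p. G (fst p) (snd p)) \<in> borel_measurable (lborel \<Otimes>\<^sub>M (\<Pi>\<^sub>M i\<in>T. lborel))"
  shows "(\<integral>\<^sup>+y. ennreal (simplex_density \<alpha> \<gamma> (insert j T) y) * G (y j) (\<lambda>i\<in>T. y i / (1 - y j))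
            \<partial>(\<Pi>\<^sub>M i\<in>insert j T. lborel)) =
     (\<integral>\<^sup>+b. ennreal (beta_density (\<alpha> j) (sum \<alpha> T + \<gamma>) b) *
         (\<integral>\<^sup>+z. ennreal (simplex_density \<alpha> \<gamma> T z) * G b z \<partial>(\<Pi>\<^sub>M i\<in>T. lborel)) \<partial>lborel)"
proof -
  let ?D = "simplex_density \<alpha> \<gamma> (insert j T)"
  define F where "F y = ennreal (?D y) * G (y j) (\<lambda>i\<in>T. y i / (1 - y j))" for y
  have comp: "(\<lambda>y. y i :: real) \<in> borel_measurable (\<Pi>\<^sub>M i\<in>insert j T. lborel)" if "i \<in> insert j T" for i
    using measurable_component_singleton[OF that, of "\<lambda>_. lborel :: real measure"] by simp
  have "(\<lambda>y :: 'i \<Rightarrow> real. (y j, \<lambda>i\<in>T. y i / (1 - y j))) \<in> (\<Pi>\<^sub>M i\<in>insert j T. lborel) \<rightarrow>\<^sub>M lborel \<Otimes>\<^sub>M (\<Pi>\<^sub>M i\<in>T. lborel)"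
    by (intro measurable_Pair measurable_restrict)
       (auto intro!: comp borel_measurable_divide borel_measurable_diff)
  from measurable_compose[OF this G] have Fm: "F \<in> borel_measurable (\<Pi>\<^sub>M i\<in>insert j T. lborel)"
    unfolding F_def using T by simp
  have "(\<integral>\<^sup>+y. F y \<partial>(\<Pi>\<^sub>M i\<in>insert j T. lborel)) = (\<integral>\<^sup>+b. (\<integral>\<^sup>+x. F (x(j := b)) \<partial>(\<Pi>\<^sub>M i\<in>T. lborel)) \<partial>lborel)"
    by (intro lborel_product.product_nn_integral_insert_rev T Fm)
  also have "\<dots> = (\<integral>\<^sup>+b. ennreal (beta_density (\<alpha> j) (sum \<alpha> T + \<gamma>) b) *
         (\<integral>\<^sup>+z. ennreal (simplex_density \<alpha> \<gamma> T z) * G b z \<partial>(\<Pi>\<^sub>M i\<in>T. lborel)) \<partial>lborel)"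
  proof (rule nn_integral_cong)
    fix b :: real
    show "(\<integral>\<^sup>+x. F (x(j := b)) \<partial>(\<Pi>\<^sub>M i\<in>T. lborel)) = ennreal (beta_density (\<alpha> j) (sum \<alpha> T + \<gamma>) b) *
         (\<integral>\<^sup>+z. ennreal (simplex_density \<alpha> \<gamma> T z) * G b z \<partial>(\<Pi>\<^sub>M i\<in>T. lborel))"
    proof (cases "0 < b \<and> b < 1")
      \<comment> \<open>For b outside (0, 1) the beta density is 0 by definition. So is the simplex
        density, because in the simplex y j is positive and at most the coordinate sum, hence below
        1.\<close>
      case False
      have "?D (x(j := b)) = 0" for x
      proof -
        have "\<not> ((\<forall>i\<in>insert j T. 0 < (x(j := b)) i) \<and> sum (x(j := b)) (insert j T) < 1)"
        proof
          assume *: "(\<forall>i\<in>insert j T. 0 < (x(j := b)) i) \<and> sum (x(j := b)) (insert j T) < 1"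
          then have "0 \<le> sum (x(j := b)) T" by (intro sum_nonneg) (auto simp: less_imp_le)
          then show False using * False T by auto
        qed
        then show ?thesis by (simp only: simplex_density_def if_False)
      qed
      then show ?thesis using False by (auto simp: F_def beta_density_def)
    next
      case True
      then have b: "0 < b" "b < 1" by auto
      have m: "(\<lambda>x. F (x(j := b))) \<in> borel_measurable (\<Pi>\<^sub>M i\<in>T. lborel)"
        by (rule measurable_compose[OF _ Fm], rule measurable_fun_upd[of _ T]) auto
      have G': "G b \<in> borel_measurable (\<Pi>\<^sub>M i\<in>T. lborel)"
        using measurable_compose[OF measurable_Pair1'[of b] G] by simp
      have "(\<integral>\<^sup>+x. F (x(j := b)) \<partial>(\<Pi>\<^sub>M i\<in>T. lborel)) = ennreal ((1 - b) ^ card T) *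
          (\<integral>\<^sup>+z. F ((\<lambda>i\<in>T. (1 - b) * z i)(j := b)) \<partial>(\<Pi>\<^sub>M i\<in>T. lborel))"
        using b by (intro nn_integral_PiM_lborel_scale[OF T(1) _ m]) auto
      also have "\<dots> = (\<integral>\<^sup>+z. ennreal ((1 - b) ^ card T) * F ((\<lambda>i\<in>T. (1 - b) * z i)(j := b)) \<partial>(\<Pi>\<^sub>M i\<in>T. lborel))"
        by (intro nn_integral_cmult[symmetric] measurable_compose[OF _ Fm] measurable_fun_upd[of _ T]) auto
      also have "\<dots> = (\<integral>\<^sup>+z. ennreal (beta_density (\<alpha> j) (sum \<alpha> T + \<gamma>) b) * (ennreal (simplex_density \<alpha> \<gamma> T z) * G b z) \<partial>(\<Pi>\<^sub>M i\<in>T. lborel))"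
      proof (rule nn_integral_cong)
        fix z :: "'i \<Rightarrow> real" assume z: "z \<in> space (\<Pi>\<^sub>M i\<in>T. lborel)"
        let ?y = "(\<lambda>i\<in>T. (1 - b) * z i)(j := b)"
        \<comment> \<open>An equality of functions, also off T: as a point of the product space, z
          is \<open>undefined\<close> there.\<close>
        have "(\<lambda>i\<in>T. ?y i / (1 - ?y j)) = z"
          using z b T by (auto simp: space_PiM PiE_def extensional_def fun_eq_iff restrict_def)
        then have "ennreal ((1 - b) ^ card T) * F ?y = ennreal ((1 - b) ^ card T * ?D ?y) * G b z"
          using b \<alpha> \<gamma> by (subst ennreal_mult) (auto simp: F_def mult.assoc intro!: simplex_density_nonneg)
        also have "(1 - b) ^ card T * ?D ?y = beta_density (\<alpha> j) (sum \<alpha> T + \<gamma>) b * simplex_density \<alpha> \<gamma> T z"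
          by (intro simplex_density_insert T \<alpha> \<gamma> b)
        also have "ennreal \<dots> = ennreal (beta_density (\<alpha> j) (sum \<alpha> T + \<gamma>) b) * ennreal (simplex_density \<alpha> \<gamma> T z)"
          using \<alpha> \<gamma> by (intro ennreal_mult beta_density_nonneg simplex_density_nonneg sum_params_pos) auto
        finally show "ennreal ((1 - b) ^ card T) * F ?y = ennreal (beta_density (\<alpha> j) (sum \<alpha> T + \<gamma>) b) * (ennreal (simplex_density \<alpha> \<gamma> T z) * G b z)"
          by (simp only: mult.assoc)
      qed
      also have "\<dots> = ennreal (beta_density (\<alpha> j) (sum \<alpha> T + \<gamma>) b) *
         (\<integral>\<^sup>+z. ennreal (simplex_density \<alpha> \<gamma> T z) * G b z \<partial>(\<Pi>\<^sub>M i\<in>T. lborel))"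
        using G' T by (intro nn_integral_cmult) auto
      finally show ?thesis .
    qed
  qed
  finally show ?thesis unfolding F_def .
qed

text \<open>Discrete stick breaking: once colour j has taken m j draws, the other n - m j draws
  follow the same law for the remaining colours. The normaliser of that smaller law is the second
  factor of the beta-binomial weight, and the two cancel.\<close>

lemma dirichlet_multinomial_insert:
  assumes T: "finite T" "j \<notin> T" and \<alpha>: "\<And>i. i \<in> T \<Longrightarrow> 0 < \<alpha> i" "0 < \<gamma>"
  shows "dirichlet_multinomial \<alpha> \<gamma> (insert j T) n m =
    beta_binomial (\<alpha> j) (sum \<alpha> T + \<gamma>) n (m j) * dirichlet_multinomial \<alpha> \<gamma> T (n - m j) m"
proof -
  have "0 < polya_weight (sum \<alpha> T + \<gamma>) (n - m j)"
    using \<alpha> by (intro polya_weight_pos sum_params_pos)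
  then show ?thesis
    using T by (simp add: dirichlet_multinomial_def beta_binomial_def add.assoc)
qed

lemma nn_integral_simplex_density_0:
  "(\<integral>\<^sup>+y. ennreal (simplex_density \<alpha> \<gamma> {} y) * f y \<partial>(\<Pi>\<^sub>M i\<in>{}. lborel)) = f (\<lambda>_. undefined)" if "0 < \<gamma>"
  using Gamma_real_pos[OF that] by (simp add: lborel_product.nn_integral_empty simplex_density_def)

text \<open>\<Phi> n rounds a point y of the simplex to counts, so the coupling is a deterministic
  map. By induction on T, the beta-binomial quantile rounds y j, and the map for the remaining draws
  rounds the other coordinates divided by 1 - y j. The two factorisations by stick breaking identify
  the law.\<close>

lemma dirichlet_multinomial_coupling:
  fixes \<alpha> :: "'i \<Rightarrow> real"
  assumes "finite T" and "\<And>i. i \<in> T \<Longrightarrow> 0 < \<alpha> i" and \<gamma>: "0 < \<gamma>"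
  obtains C \<Phi> where "0 \<le> C"
    and "\<And>n i. i \<in> T \<Longrightarrow> (\<lambda>y. \<Phi> n y i) \<in> (\<Pi>\<^sub>M i\<in>T. lborel) \<rightarrow>\<^sub>M count_space (UNIV :: nat set)"
    and "\<And>n y. (\<And>i. i \<in> T \<Longrightarrow> 0 < y i) \<Longrightarrow> sum y T < 1 \<Longrightarrow> sum (\<Phi> n y) T \<le> n"
    and "\<And>n y i. (\<And>i. i \<in> T \<Longrightarrow> 0 < y i) \<Longrightarrow> sum y T < 1 \<Longrightarrow> i \<in> T \<Longrightarrow>
           \<bar>real (\<Phi> n y i) - real n * y i\<bar> \<le> C"
    and "\<And>n m. sum m T \<le> n \<Longrightarrow>
      (\<integral>\<^sup>+y. ennreal (simplex_density \<alpha> \<gamma> T y) * indicator {y. \<forall>i\<in>T. \<Phi> n y i = m i} y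
         \<partial>(\<Pi>\<^sub>M i\<in>T. lborel)) = ennreal (dirichlet_multinomial \<alpha> \<gamma> T n m)"
proof -
  define P where "P T C \<Phi> \<longleftrightarrow> 0 \<le> C \<and>
    (\<forall>n. \<forall>i\<in>T. (\<lambda>y. \<Phi> n y i) \<in> (\<Pi>\<^sub>M i\<in>T. lborel) \<rightarrow>\<^sub>M count_space (UNIV :: nat set)) \<and>
    (\<forall>n y. (\<forall>i\<in>T. 0 < y i) \<longrightarrow> sum y T < 1 \<longrightarrow>
       sum (\<Phi> n y) T \<le> n \<and> (\<forall>i\<in>T. \<bar>real (\<Phi> n y i) - real n * y i\<bar> \<le> C)) \<and>
    (\<forall>n m. sum m T \<le> n \<longrightarrow>
      (\<integral>\<^sup>+y. ennreal (simplex_density \<alpha> \<gamma> T y) * indicator {y. \<forall>i\<in>T. \<Phi> n y i = m i} y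
         \<partial>(\<Pi>\<^sub>M i\<in>T. lborel)) = ennreal (dirichlet_multinomial \<alpha> \<gamma> T n m))"
    for T :: "'i set" and C and \<Phi> :: "nat \<Rightarrow> ('i \<Rightarrow> real) \<Rightarrow> 'i \<Rightarrow> nat"
  have "\<exists>C \<Phi>. P T C \<Phi>"
    using assms(1,2)
  proof (induction T rule: finite_induct)
    case empty
    have "P {} 0 (\<lambda>_ _ _. 0)"
      using \<gamma> polya_weight_pos[OF \<gamma>] nn_integral_simplex_density_0[OF \<gamma>, of \<alpha> "\<lambda>_. 1"]
      by (simp add: P_def nn_integral_simplex_density_0 dirichlet_multinomial_def less_imp_neq[symmetric])
    then show ?case by blast
  next
    case (insert j T)
    then obtain C \<Phi> where "P T C \<Phi>" by auto
    then have C: "0 \<le> C"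
      and meas: "\<And>n i. i \<in> T \<Longrightarrow> (\<lambda>y. \<Phi> n y i) \<in> (\<Pi>\<^sub>M i\<in>T. lborel) \<rightarrow>\<^sub>M count_space UNIV"
      and sum_le: "\<And>n y. \<forall>i\<in>T. 0 < y i \<Longrightarrow> sum y T < 1 \<Longrightarrow> sum (\<Phi> n y) T \<le> n"
      and close: "\<And>n y i. \<forall>i\<in>T. 0 < y i \<Longrightarrow> sum y T < 1 \<Longrightarrow> i \<in> T \<Longrightarrow> \<bar>real (\<Phi> n y i) - real n * y i\<bar> \<le> C"
      and law: "\<And>n m. sum m T \<le> n \<Longrightarrow>
        (\<integral>\<^sup>+y. ennreal (simplex_density \<alpha> \<gamma> T y) * indicator {y. \<forall>i\<in>T. \<Phi> n y i = m i} y
           \<partial>(\<Pi>\<^sub>M i\<in>T. lborel)) = ennreal (dirichlet_multinomial \<alpha> \<gamma> T n m)"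
      unfolding P_def by blast+
    note T = insert.hyps
    have \<alpha>: "\<And>i. i \<in> T \<Longrightarrow> 0 < \<alpha> i" "0 < \<alpha> j" using insert.prems by auto
    define A where "A = sum \<alpha> T + \<gamma>"
    have A: "0 < A" unfolding A_def using \<alpha> \<gamma> by (intro sum_params_pos)
    define q where "q = beta_binomial_quantile (\<alpha> j) A"
    \<comment> \<open>The integer called j in \<open>beta_binomial_quantile_close\<close>. It must
      dominate both beta parameters, one for each of the two one-sided bounds.\<close>
    obtain l where l: "max (\<alpha> j) A \<le> real l" using real_arch_simple by blast
    then have l: "\<alpha> j \<le> real l" "A \<le> real l" "0 < l" using A by auto
    define z where "z y = (\<lambda>i\<in>T. y i / (1 - y j))" for y :: "'i \<Rightarrow> real"
    define \<Psi> where "\<Psi> n y i = (if i = j then q n (y j) else \<Phi> (n - q n (y j)) (z y) i)" for n y i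
    have comp: "(\<lambda>y. y i :: real) \<in> borel_measurable (\<Pi>\<^sub>M i\<in>insert j T. lborel)" if "i \<in> insert j T" for i
      using measurable_component_singleton[OF that, of "\<lambda>_. lborel :: real measure"] by simp
    have z_meas: "z \<in> (\<Pi>\<^sub>M i\<in>insert j T. lborel) \<rightarrow>\<^sub>M (\<Pi>\<^sub>M i\<in>T. lborel)"
      unfolding z_def by (intro measurable_restrict) (auto intro!: comp borel_measurable_divide borel_measurable_diff)
    have q_meas: "q n \<in> borel \<rightarrow>\<^sub>M count_space UNIV" for n
      unfolding q_def by (rule beta_binomial_quantile_measurable[OF \<alpha>(2) A])
    have qj_meas: "(\<lambda>y. q n (y j)) \<in> (\<Pi>\<^sub>M i\<in>insert j T. lborel) \<rightarrow>\<^sub>M count_space UNIV" for n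
      by (rule measurable_compose[OF comp q_meas]) simp
    have "P (insert j T) (C + real l) \<Psi>"
      unfolding P_def
    proof (intro conjI allI impI ballI)
      show "0 \<le> C + real l" using C by simp
      fix n i assume i: "i \<in> insert j T"
      show "(\<lambda>y. \<Psi> n y i) \<in> (\<Pi>\<^sub>M i\<in>insert j T. lborel) \<rightarrow>\<^sub>M count_space UNIV"
      proof (cases "i = j")
        case True
        then show ?thesis using qj_meas by (simp add: \<Psi>_def)
      next
        case False
        then have "i \<in> T" using i by auto
        \<comment> \<open>The number of draws handed to \<Phi> itself depends on y. It takes
          countably many values, so measurability for each fixed k is enough.\<close>
        have "(\<lambda>y. (\<lambda>k y. \<Phi> (n - k) (z y) i) (q n (y j)) y) \<in> (\<Pi>\<^sub>M i\<in>insert j T. lborel) \<rightarrow>\<^sub>M count_space UNIV"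
          by (rule measurable_compose_countable[OF measurable_compose[OF z_meas meas[OF \<open>i \<in> T\<close>]] qj_meas])
        then show ?thesis using False by (simp add: \<Psi>_def)
      qed
    next
      fix n and y :: "'i \<Rightarrow> real" assume y: "\<forall>i\<in>insert j T. 0 < y i" "sum y (insert j T) < 1"
      have b: "0 < y j" "sum y T < 1 - y j" "0 \<le> sum y T"
        using y T by (auto intro!: sum_nonneg simp: less_imp_le)
      have zpos: "\<forall>i\<in>T. 0 < z y i" using y b by (auto simp: z_def)
      have zsum: "sum (z y) T < 1"
        using b by (simp add: z_def flip: sum_divide_distrib)
      have qn: "q n (y j) \<le> n"
        unfolding q_def using b by (intro beta_binomial_quantile_le \<alpha> A) auto
      have qc: "\<bar>real (q n (y j)) - real n * y j\<bar> \<le> real l"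
        unfolding q_def using b by (intro beta_binomial_quantile_close \<alpha> A l) auto
      have \<Psi>T: "\<Psi> n y i = \<Phi> (n - q n (y j)) (z y) i" if "i \<in> T" for i
        using that T by (auto simp: \<Psi>_def)
      show "sum (\<Psi> n y) (insert j T) \<le> n"
        using T sum_le[OF zpos zsum, of "n - q n (y j)"] qn by (simp add: \<Psi>T) (simp add: \<Psi>_def)
      fix i assume "i \<in> insert j T"
      show "\<bar>real (\<Psi> n y i) - real n * y i\<bar> \<le> C + real l"
      proof (cases "i = j")
        case True
        then show ?thesis using qc C by (simp add: \<Psi>_def)
      next
        case False
        then have i: "i \<in> T" using \<open>i \<in> insert j T\<close> by auto
        have zi: "z y i \<le> 1"
          using zsum zpos member_le_sum[of i T "z y"] i T by (auto simp: less_imp_le)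
        have yi: "y i = (1 - y j) * z y i" using i b by (simp add: z_def)
        \<comment> \<open>The error splits into the rounding error for the remaining draws and the
          error made at j times z y i, a number in [0, 1]. Hence the constants C and l add.\<close>
        have "real (\<Psi> n y i) - real n * y i = (real (\<Phi> (n - q n (y j)) (z y) i) - real (n - q n (y j)) * z y i)
            - (real (q n (y j)) - real n * y j) * z y i"
          unfolding \<Psi>T[OF i] yi using qn by (simp add: of_nat_diff algebra_simps)
        moreover have "\<bar>(real (q n (y j)) - real n * y j) * z y i\<bar> \<le> real l * 1"
          unfolding abs_mult using qc zi zpos i by (intro mult_mono) (auto simp: less_imp_le)
        moreover have "\<bar>real (\<Phi> (n - q n (y j)) (z y) i) - real (n - q n (y j)) * z y i\<bar> \<le> C"
          by (rule close[OF zpos zsum i])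
        ultimately show ?thesis by linarith
      qed
    next
      fix n and m :: "'i \<Rightarrow> nat" assume m: "sum m (insert j T) \<le> n"
      then have mj: "m j \<le> n" and mT: "sum m T \<le> n - m j" using T by auto
      \<comment> \<open>When the quantile of y j equals m j, the number of draws handed to \<Phi> is
        the fixed n - m j. So the event splits into R, a condition on y j, and S, a condition on the
        rescaled rest.\<close>
      define S where "S = {x \<in> space (\<Pi>\<^sub>M i\<in>T. lborel). \<forall>i\<in>T. \<Phi> (n - m j) x i = m i}"
      have "{x \<in> space (\<Pi>\<^sub>M i\<in>T. lborel). \<Phi> (n - m j) x i = m i} \<in> sets (\<Pi>\<^sub>M i\<in>T. lborel)" if "i \<in> T" for i
        using measurable_sets[OF meas[OF that], of "{m i}" "n - m j"] by (simp add: vimage_def Int_def conj_commute)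
      then have S [measurable]: "S \<in> sets (\<Pi>\<^sub>M i\<in>T. lborel)"
        unfolding S_def by (intro sets.sets_Collect_finite_All T(1))
      define R where "R = {b. q n b = m j}"
      have R [measurable]: "R \<in> sets borel"
        using measurable_sets[OF q_meas, of "{m j}" n] by (simp add: R_def vimage_def)
      have "(\<integral>\<^sup>+y. ennreal (simplex_density \<alpha> \<gamma> (insert j T) y) *
            indicator {y. \<forall>i\<in>insert j T. \<Psi> n y i = m i} y \<partial>(\<Pi>\<^sub>M i\<in>insert j T. lborel)) =
          (\<integral>\<^sup>+y. ennreal (simplex_density \<alpha> \<gamma> (insert j T) y) *
            (indicator R (y j) * indicator S (\<lambda>i\<in>T. y i / (1 - y j))) \<partial>(\<Pi>\<^sub>M i\<in>insert j T. lborel))"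
        using T by (intro nn_integral_cong arg_cong2[where f="(*)"] refl)
           (auto simp: indicator_def \<Psi>_def S_def R_def z_def space_PiM)
      also have "\<dots> = (\<integral>\<^sup>+b. ennreal (beta_density (\<alpha> j) A b) *
         (\<integral>\<^sup>+x. ennreal (simplex_density \<alpha> \<gamma> T x) * (indicator R b * indicator S x) \<partial>(\<Pi>\<^sub>M i\<in>T. lborel)) \<partial>lborel)"
        unfolding A_def by (intro nn_integral_simplex_density_insert T \<alpha> \<gamma>) measurable
      also have "\<dots> = (\<integral>\<^sup>+b. ennreal (beta_density (\<alpha> j) A b) * indicator R b *
         (\<integral>\<^sup>+x. ennreal (simplex_density \<alpha> \<gamma> T x) * indicator S x \<partial>(\<Pi>\<^sub>M i\<in>T. lborel)) \<partial>lborel)"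
        by (intro nn_integral_cong) (auto simp: indicator_def)
      also have "(\<integral>\<^sup>+x. ennreal (simplex_density \<alpha> \<gamma> T x) * indicator S x \<partial>(\<Pi>\<^sub>M i\<in>T. lborel)) =
          ennreal (dirichlet_multinomial \<alpha> \<gamma> T (n - m j) m)"
        unfolding law[OF mT, symmetric] by (intro nn_integral_cong) (auto simp: S_def indicator_def)
      also have "(\<integral>\<^sup>+b. ennreal (beta_density (\<alpha> j) A b) * indicator R b *
          ennreal (dirichlet_multinomial \<alpha> \<gamma> T (n - m j) m) \<partial>lborel) =
          (\<integral>\<^sup>+b. ennreal (beta_density (\<alpha> j) A b) * indicator R b \<partial>lborel) *
          ennreal (dirichlet_multinomial \<alpha> \<gamma> T (n - m j) m)"
        by (intro nn_integral_multc) measurable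
      also have "(\<integral>\<^sup>+b. ennreal (beta_density (\<alpha> j) A b) * indicator R b \<partial>lborel) = ennreal (beta_binomial (\<alpha> j) A n (m j))"
        unfolding R_def q_def by (intro nn_integral_beta_quantile_eq \<alpha> A mj)
      also have "\<dots> * ennreal (dirichlet_multinomial \<alpha> \<gamma> T (n - m j) m) =
          ennreal (dirichlet_multinomial \<alpha> \<gamma> (insert j T) n m)"
        using dirichlet_multinomial_insert[OF T, of \<alpha> \<gamma> n m] \<alpha>(1) \<gamma> beta_binomial_nonneg[OF \<alpha>(2) A, of n "m j"]
        by (simp add: A_def[symmetric] ennreal_mult')
      finally show "(\<integral>\<^sup>+y. ennreal (simplex_density \<alpha> \<gamma> (insert j T) y) *
            indicator {y. \<forall>i\<in>insert j T. \<Psi> n y i = m i} y \<partial>(\<Pi>\<^sub>M i\<in>insert j T. lborel)) =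
          ennreal (dirichlet_multinomial \<alpha> \<gamma> (insert j T) n m)" .
    qed
    then show ?case by blast
  qed
  then obtain C \<Phi> where "P T C \<Phi>" by blast
  then show thesis
    unfolding P_def by (intro that[of C \<Phi>]) blast+
qed

section \<open>The law of the urn\<close>

text \<open>Natural-number form of \<open>draws\<close>: its values lie in a countable type, where
  laws can be compared on singletons.\<close>

definition draw_count :: "real \<Rightarrow> (nat \<Rightarrow> 'w \<Rightarrow> real^'q) \<Rightarrow> nat \<Rightarrow> 'w \<Rightarrow> 'q \<Rightarrow> nat" where
  "draw_count a X n \<omega> i = card {k. k < n \<and> X (Suc k) \<omega> = X k \<omega> + a *\<^sub>R axis i 1}"

definition urn_state :: "real \<Rightarrow> real^'q \<Rightarrow> ('q \<Rightarrow> nat) \<Rightarrow> real^'q" where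
  "urn_state a x\<^sub>0 y = x\<^sub>0 + a *\<^sub>R (\<chi> i. real (y i))"

lemma draws_draw_count: "draws a X n \<omega> = (\<chi> i. real (draw_count a X n \<omega> i))"
  by (simp add: draws_def draw_count_def)

lemma draw_count_0 [simp]: "draw_count a X 0 \<omega> i = 0"
  by (simp add: draw_count_def)

lemma draw_count_Suc:
  "draw_count a X (Suc n) \<omega> i =
     draw_count a X n \<omega> i + (if X (Suc n) \<omega> = X n \<omega> + a *\<^sub>R axis i 1 then 1 else 0)"
proof -
  let ?P = "\<lambda>k. X (Suc k) \<omega> = X k \<omega> + a *\<^sub>R axis i 1"
  have "{k. k < Suc n \<and> ?P k} = {k. k < n \<and> ?P k} \<union> (if ?P n then {n} else {})"
    by (auto simp: less_Suc_eq)
  then show ?thesis by (simp add: draw_count_def card_insert_if)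
qed

lemma urn_state_inj: "a \<noteq> 0 \<Longrightarrow> urn_state a x\<^sub>0 y = urn_state a x\<^sub>0 y' \<longleftrightarrow> y = y'"
  by (auto simp: urn_state_def vec_eq_iff fun_eq_iff)

lemma urn_state_upd: "urn_state a x\<^sub>0 (y(i := Suc (y i))) = urn_state a x\<^sub>0 y + a *\<^sub>R axis i 1"
  by (auto simp: urn_state_def vec_eq_iff axis_def algebra_simps)

lemma sum_upd_Suc: "sum (y(i := Suc (y i))) (UNIV :: 'q::finite set) = Suc (sum y UNIV)"
proof -
  have "sum (y(i := Suc (y i))) UNIV = sum (\<lambda>j. y j + (if j = i then 1 else 0)) UNIV"
    by (intro sum.cong) auto
  then show ?thesis by (simp add: sum.distrib)
qed

text \<open>A statement about a single path. The jumps for different colours are distinct because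
  \<open>a\<close> is nonzero, so every step raises exactly one count by one.\<close>

lemma urn_state_draw_count:
  assumes "a \<noteq> 0" "X 0 \<omega> = x\<^sub>0" "\<And>k. k < n \<Longrightarrow> \<exists>i. X (Suc k) \<omega> = X k \<omega> + a *\<^sub>R axis i 1"
  shows "X n \<omega> = urn_state a x\<^sub>0 (draw_count a X n \<omega>) \<and> sum (draw_count a X n \<omega>) UNIV = n"
  using assms(3)
proof (induction n)
  case 0
  then show ?case using assms(2) by (simp add: urn_state_def zero_vec_def[symmetric])
next
  case (Suc n)
  then obtain i where i: "X (Suc n) \<omega> = X n \<omega> + a *\<^sub>R axis i 1" by blast
  have upd: "draw_count a X (Suc n) \<omega> = (draw_count a X n \<omega>)(i := Suc (draw_count a X n \<omega> i))"
    using assms(1) by (auto simp: draw_count_Suc i axis_eq_axis fun_eq_iff)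
  have "X n \<omega> = urn_state a x\<^sub>0 (draw_count a X n \<omega>) \<and> sum (draw_count a X n \<omega>) UNIV = n"
    using Suc by simp
  then show ?case unfolding upd urn_state_upd sum_upd_Suc i by simp
qed

lemma l1norm_urn_state:
  assumes "a > 0" "\<And>i. x\<^sub>0 $ i > 0"
  shows "l1norm (urn_state a x\<^sub>0 y) = a * ((\<Sum>i\<in>UNIV. x\<^sub>0 $ i / a) + real (sum y UNIV))"
proof -
  have "\<bar>urn_state a x\<^sub>0 y $ i\<bar> = a * (x\<^sub>0 $ i / a + real (y i))" for i
    using assms(1) assms(2)[of i] by (simp add: urn_state_def field_simps)
  then show ?thesis
    by (simp add: l1norm_def sum.distrib flip: sum_distrib_left)
qed

locale polya_urn_process =
  fixes M :: "'w measure" and a :: real and x\<^sub>0 :: "real^'q" and X :: "nat \<Rightarrow> 'w \<Rightarrow> real^'q"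
  assumes urn: "polya_urn M a x\<^sub>0 X" and a: "a > 0" and x0: "\<And>i. x\<^sub>0 $ i > 0"

sublocale polya_urn_process \<subseteq> prob_space M
  using urn by (simp add: polya_urn_def)

context polya_urn_process
begin

lemma X_measurable [measurable]: "X n \<in> borel_measurable M"
  using urn by (simp add: polya_urn_def)

abbreviation path_prob :: "nat \<Rightarrow> (nat \<Rightarrow> real^'q) \<Rightarrow> real" where
  "path_prob n s \<equiv> \<P>(\<omega> in M. \<forall>k\<le>n. X k \<omega> = s k)"

text \<open>Clearing the denominator of the conditional probability extends the transition rule to
  null histories, where both sides are 0.\<close>

lemma prob_step_path:
  "\<P>(\<omega> in M. X (Suc n) \<omega> = s n + a *\<^sub>R axis i 1 \<and> (\<forall>k\<le>n. X k \<omega> = s k)) =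
     s n $ i / l1norm (s n) * path_prob n s"
proof (cases "path_prob n s > 0")
  case True
  then have "\<P>(\<omega> in M. X (Suc n) \<omega> = s n + a *\<^sub>R axis i 1 \<bar> \<forall>k\<le>n. X k \<omega> = s k) = s n $ i / l1norm (s n)"
    using urn by (simp add: polya_urn_def)
  then show ?thesis using True by (simp add: cond_prob_def field_simps)
next
  case False
  then have 0: "path_prob n s = 0" using measure_nonneg[of M] by (meson antisym_conv1 not_le)
  have "\<P>(\<omega> in M. X (Suc n) \<omega> = s n + a *\<^sub>R axis i 1 \<and> (\<forall>k\<le>n. X k \<omega> = s k)) \<le> path_prob n s"
    by (intro finite_measure_mono) auto
  then show ?thesis using 0 by (simp add: measure_le_0_iff)
qed

text \<open>\<open>polya_urn\<close> only prescribes the probabilities of the jumps. An urn state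
  has positive coordinates, so their sum is the \<open>l1norm\<close>, the prescribed probabilities
  add up to 1, and no other jump has positive probability.\<close>

lemma AE_step_path:
  assumes s: "s n = urn_state a x\<^sub>0 y"
  shows "AE \<omega> in M. (\<forall>k\<le>n. X k \<omega> = s k) \<longrightarrow> (\<exists>i. X (Suc n) \<omega> = s n + a *\<^sub>R axis i 1)"
proof -
  let ?A = "{\<omega>\<in>space M. \<forall>k\<le>n. X k \<omega> = s k}"
  let ?B = "{\<omega>\<in>space M. (\<exists>i. X (Suc n) \<omega> = s n + a *\<^sub>R axis i 1) \<and> (\<forall>k\<le>n. X k \<omega> = s k)}"
  have pos: "s n $ i > 0" for i
    using a x0[of i] by (simp add: s urn_state_def add_pos_nonneg)
  have B: "?B \<in> events" by measurable
  have "prob ?B = (\<Sum>i\<in>UNIV. \<P>(\<omega> in M. X (Suc n) \<omega> = s n + a *\<^sub>R axis i 1 \<and> (\<forall>k\<le>n. X k \<omega> = s k)))"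
    using a by (intro prob_sum) (auto simp: axis_eq_axis)
  also have "\<dots> = (\<Sum>i\<in>UNIV. s n $ i) / l1norm (s n) * prob ?A"
    by (simp only: prob_step_path sum_distrib_right sum_divide_distrib)
  also have "(\<Sum>i\<in>UNIV. s n $ i) = l1norm (s n)"
    using pos by (simp add: l1norm_def abs_of_pos)
  also have "l1norm (s n) / l1norm (s n) = 1"
    using sum_pos[of UNIV "\<lambda>i. s n $ i"] pos by (simp add: l1norm_def abs_of_pos)
  finally have "prob ?B = prob ?A" by simp
  then have "prob (?A - ?B) = 0"
    by (subst finite_measure_Diff) auto
  then have "AE \<omega> in M. \<omega> \<notin> ?A - ?B"
    by (subst (asm) prob_eq_0) auto
  then show ?thesis
    using AE_space by eventually_elim auto
qed

text \<open>\<open>polya_urn\<close> gives information about individual histories of positive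
  probability, so the process must first be shown to be discrete. Each history has one extension per
  colour, and \<open>AE_step_path\<close> shows that nothing else occurs. Being
  \<open>extensional\<close>, a history is determined by its values up to time n.\<close>

lemma finite_histories:
  "\<exists>S. finite S \<and> S \<subseteq> extensional {..n} \<and> (\<forall>s\<in>S. \<exists>y. s n = urn_state a x\<^sub>0 y) \<and>
     (AE \<omega> in M. \<exists>s\<in>S. \<forall>k\<le>n. X k \<omega> = s k)"
proof (induction n)
  case 0
  have "AE \<omega> in M. X 0 \<omega> = x\<^sub>0" using urn by (simp add: polya_urn_def)
  then show ?case
    by (intro exI[of _ "{\<lambda>k\<in>{..0}. x\<^sub>0}"]) 
       (auto simp: urn_state_def zero_vec_def[symmetric] intro!: exI[of _ "\<lambda>_. 0"])
next
  case (Suc n)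
  then obtain S where S: "finite S" "S \<subseteq> extensional {..n}" "\<And>s. s \<in> S \<Longrightarrow> \<exists>y. s n = urn_state a x\<^sub>0 y"
    "AE \<omega> in M. \<exists>s\<in>S. \<forall>k\<le>n. X k \<omega> = s k" by blast
  let ?S = "(\<lambda>(s, i). s(Suc n := s n + a *\<^sub>R axis i 1)) ` (S \<times> UNIV)"
  have "AE \<omega> in M. \<forall>s\<in>S. (\<forall>k\<le>n. X k \<omega> = s k) \<longrightarrow> (\<exists>i. X (Suc n) \<omega> = s n + a *\<^sub>R axis i 1)"
    using S(1,3) AE_step_path by (intro AE_finite_allI) blast+
  with S(4) have "AE \<omega> in M. \<exists>s\<in>?S. \<forall>k\<le>Suc n. X k \<omega> = s k"
  proof eventually_elim
    case (elim \<omega>)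
    then obtain s i where "s \<in> S" "\<forall>k\<le>n. X k \<omega> = s k" "X (Suc n) \<omega> = s n + a *\<^sub>R axis i 1" by blast
    then show ?case
      by (intro bexI[of _ "s(Suc n := s n + a *\<^sub>R axis i 1)"]) (auto simp: le_Suc_eq)
  qed
  moreover have "?S \<subseteq> extensional {..Suc n}"
    using S(2) by (auto simp: extensional_def)
  moreover have "\<exists>y. s (Suc n) = urn_state a x\<^sub>0 y" if "s \<in> ?S" for s
    using that S(3) urn_state_upd[of a x\<^sub>0, symmetric] by fastforce
  ultimately show ?case using S(1) by (intro exI[of _ ?S]) auto
qed

lemma AE_step: "AE \<omega> in M. \<exists>i. X (Suc n) \<omega> = X n \<omega> + a *\<^sub>R axis i 1"
proof -
  obtain S where S: "finite S" "\<And>s. s \<in> S \<Longrightarrow> \<exists>y. s n = urn_state a x\<^sub>0 y"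
    "AE \<omega> in M. \<exists>s\<in>S. \<forall>k\<le>n. X k \<omega> = s k" using finite_histories[of n] by blast
  have "AE \<omega> in M. \<forall>s\<in>S. (\<forall>k\<le>n. X k \<omega> = s k) \<longrightarrow> (\<exists>i. X (Suc n) \<omega> = s n + a *\<^sub>R axis i 1)"
    using S(1,2) AE_step_path by (intro AE_finite_allI) blast+
  with S(3) show ?thesis
  proof eventually_elim
    case (elim \<omega>)
    then obtain s i where "\<forall>k\<le>n. X k \<omega> = s k" "X (Suc n) \<omega> = s n + a *\<^sub>R axis i 1" by blast
    then show ?case by (intro exI[of _ i]) simp
  qed
qed

lemma AE_urn_state:
  "AE \<omega> in M. X n \<omega> = urn_state a x\<^sub>0 (draw_count a X n \<omega>) \<and> sum (draw_count a X n \<omega>) UNIV = n"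
proof -
  have "AE \<omega> in M. \<forall>n. \<exists>i. X (Suc n) \<omega> = X n \<omega> + a *\<^sub>R axis i 1"
    unfolding AE_all_countable using AE_step by blast
  moreover have "AE \<omega> in M. X 0 \<omega> = x\<^sub>0" using urn by (simp add: polya_urn_def)
  ultimately show ?thesis
  proof eventually_elim
    case (elim \<omega>)
    then show ?case using a by (intro urn_state_draw_count) auto
  qed
qed

text \<open>Sums \<open>prob_step_path\<close> over the finitely many histories ending in v. Almost
  surely exactly one history in the finite set matches the path, which makes the decomposition
  disjoint.\<close>

lemma prob_transition:
  "\<P>(\<omega> in M. X (Suc n) \<omega> = v + a *\<^sub>R axis i 1 \<and> X n \<omega> = v) = v $ i / l1norm v * \<P>(\<omega> in M. X n \<omega> = v)"
proof -
  obtain S where S: "finite S" "S \<subseteq> extensional {..n}"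
    "AE \<omega> in M. \<exists>s\<in>S. \<forall>k\<le>n. X k \<omega> = s k" using finite_histories[of n] by blast
  let ?I = "{s\<in>S. s n = v}"
  have path: "AE \<omega> in M. \<exists>!s\<in>S. \<forall>k\<le>n. X k \<omega> = s k"
    using S(3)
  proof eventually_elim
    case (elim \<omega>)
    have "s = s'" if "s \<in> S" "s' \<in> S" "\<forall>k\<le>n. X k \<omega> = s k" "\<forall>k\<le>n. X k \<omega> = s' k" for s s'
      using that S(2) by (intro extensionalityI[of s "{..n}" s']) auto
    with elim show ?case by blast
  qed
  have "\<P>(\<omega> in M. X n \<omega> = v) = (\<Sum>s\<in>?I. path_prob n s)"
  proof (rule prob_sum)
    show "AE \<omega> in M. (\<forall>s\<in>?I. (\<forall>k\<le>n. X k \<omega> = s k) \<longrightarrow> X n \<omega> = v) \<and>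
      (X n \<omega> = v \<longrightarrow> (\<exists>!s\<in>?I. \<forall>k\<le>n. X k \<omega> = s k))"
      using path
    proof eventually_elim
      case (elim \<omega>)
      define Q where "Q s \<longleftrightarrow> (\<forall>k\<le>n. X k \<omega> = s k)" for s
      obtain s\<^sub>0 where s\<^sub>0: "s\<^sub>0 \<in> S" "\<And>s. s \<in> S \<Longrightarrow> Q s \<longleftrightarrow> s = s\<^sub>0"
        using elim unfolding Q_def[symmetric] by blast
      then have "X n \<omega> = s\<^sub>0 n" unfolding Q_def by blast
      with s\<^sub>0 show ?case unfolding Q_def[symmetric] by auto
    qed
  qed (use S(1) in auto)
  moreover have "\<P>(\<omega> in M. X (Suc n) \<omega> = v + a *\<^sub>R axis i 1 \<and> X n \<omega> = v) =
     (\<Sum>s\<in>?I. \<P>(\<omega> in M. X (Suc n) \<omega> = s n + a *\<^sub>R axis i 1 \<and> (\<forall>k\<le>n. X k \<omega> = s k)))"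
  proof (rule prob_sum)
    show "AE \<omega> in M. (\<forall>s\<in>?I. (X (Suc n) \<omega> = s n + a *\<^sub>R axis i 1 \<and> (\<forall>k\<le>n. X k \<omega> = s k)) \<longrightarrow>
        X (Suc n) \<omega> = v + a *\<^sub>R axis i 1 \<and> X n \<omega> = v) \<and>
      (X (Suc n) \<omega> = v + a *\<^sub>R axis i 1 \<and> X n \<omega> = v \<longrightarrow>
       (\<exists>!s\<in>?I. X (Suc n) \<omega> = s n + a *\<^sub>R axis i 1 \<and> (\<forall>k\<le>n. X k \<omega> = s k)))"
      using path
    proof eventually_elim
      case (elim \<omega>)
      define Q where "Q s \<longleftrightarrow> (\<forall>k\<le>n. X k \<omega> = s k)" for s
      obtain s\<^sub>0 where s\<^sub>0: "s\<^sub>0 \<in> S" "\<And>s. s \<in> S \<Longrightarrow> Q s \<longleftrightarrow> s = s\<^sub>0"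
        using elim unfolding Q_def[symmetric] by blast
      then have "X n \<omega> = s\<^sub>0 n" unfolding Q_def by blast
      with s\<^sub>0 show ?case unfolding Q_def[symmetric] by auto
    qed
  qed (use S(1) in auto)
  moreover have "(\<Sum>s\<in>?I. \<P>(\<omega> in M. X (Suc n) \<omega> = s n + a *\<^sub>R axis i 1 \<and> (\<forall>k\<le>n. X k \<omega> = s k))) =
      (\<Sum>s\<in>?I. v $ i / l1norm v * path_prob n s)"
    by (intro sum.cong refl) (subst prob_step_path, simp)
  ultimately show ?thesis by (simp add: sum_distrib_left)
qed

text \<open>Induction through the colour i drawn last, which lowers y i by one in the preceding
  state. The recursion of \<open>polya_weight\<close> turns this contribution into w times y i over
  a factor free of i, and the y i add up to n + 1.\<close>

lemma prob_urn_state: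
  assumes "sum y UNIV = n"
  shows "\<P>(\<omega> in M. X n \<omega> = urn_state a x\<^sub>0 y) =
     (\<Prod>i\<in>UNIV. polya_weight (x\<^sub>0 $ i / a) (y i)) / polya_weight (\<Sum>i\<in>UNIV. x\<^sub>0 $ i / a) n"
  using assms
proof (induction n arbitrary: y)
  case 0
  then have y: "y = (\<lambda>_. 0)" by (simp add: fun_eq_iff)
  have "AE \<omega> in M. X 0 \<omega> = x\<^sub>0" using urn by (simp add: polya_urn_def)
  then have "\<P>(\<omega> in M. X 0 \<omega> = x\<^sub>0) = 1" by (subst prob_Collect_eq_1) auto
  then show ?case by (simp add: y urn_state_def zero_vec_def[symmetric])
next
  case (Suc n)
  define A where "A = (\<Sum>i\<in>UNIV. x\<^sub>0 $ i / a)"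
  define w where "w = (\<Prod>i\<in>UNIV. polya_weight (x\<^sub>0 $ i / a) (y i))"
  have A: "0 < A" unfolding A_def using a x0 by (intro sum_pos) auto
  have wA: "0 < polya_weight A n" by (rule polya_weight_pos[OF A])
  have "\<P>(\<omega> in M. X (Suc n) \<omega> = urn_state a x\<^sub>0 y) =
    (\<Sum>i\<in>UNIV. \<P>(\<omega> in M. X (Suc n) \<omega> = (urn_state a x\<^sub>0 y - a *\<^sub>R axis i 1) + a *\<^sub>R axis i 1 \<and>
       X n \<omega> = urn_state a x\<^sub>0 y - a *\<^sub>R axis i 1))"
  proof (rule prob_sum)
    show "AE \<omega> in M. (\<forall>i\<in>UNIV. (X (Suc n) \<omega> = (urn_state a x\<^sub>0 y - a *\<^sub>R axis i 1) + a *\<^sub>R axis i 1 \<and>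
         X n \<omega> = urn_state a x\<^sub>0 y - a *\<^sub>R axis i 1) \<longrightarrow> X (Suc n) \<omega> = urn_state a x\<^sub>0 y) \<and>
      (X (Suc n) \<omega> = urn_state a x\<^sub>0 y \<longrightarrow> (\<exists>!i\<in>UNIV. X (Suc n) \<omega> = (urn_state a x\<^sub>0 y - a *\<^sub>R axis i 1) + a *\<^sub>R axis i 1 \<and>
         X n \<omega> = urn_state a x\<^sub>0 y - a *\<^sub>R axis i 1))"
      using AE_step[of n] by eventually_elim (use a in \<open>auto simp: axis_eq_axis algebra_simps\<close>)
  qed auto
  also have "\<dots> = (\<Sum>i\<in>UNIV. w * real (y i) / ((A + real n) * polya_weight A n))"
  proof (rule sum.cong[OF refl])
    fix i
    let ?v = "urn_state a x\<^sub>0 y - a *\<^sub>R axis i 1"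
    show "\<P>(\<omega> in M. X (Suc n) \<omega> = ?v + a *\<^sub>R axis i 1 \<and> X n \<omega> = ?v) = w * real (y i) / ((A + real n) * polya_weight A n)"
    proof (cases "y i")
      case 0
      \<comment> \<open>With y i = 0 the predecessor would need a negative count. It is not an urn
        state, so it is almost surely never visited, in agreement with the factor y i.\<close>
      have v: "?v \<noteq> urn_state a x\<^sub>0 y'" for y'
      proof
        assume "?v = urn_state a x\<^sub>0 y'"
        then have "?v $ i = urn_state a x\<^sub>0 y' $ i" by simp
        then have "a * (1 + real (y' i)) = 0" using 0 by (simp add: urn_state_def algebra_simps)
        then show False using a by (simp add: add_nonneg_eq_0_iff)
      qed
      have "AE \<omega> in M. \<not> (X (Suc n) \<omega> = ?v + a *\<^sub>R axis i 1 \<and> X n \<omega> = ?v)"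
        using AE_urn_state[of n] by eventually_elim (use v in metis)
      then have "\<P>(\<omega> in M. X (Suc n) \<omega> = ?v + a *\<^sub>R axis i 1 \<and> X n \<omega> = ?v) = 0"
        by (subst prob_Collect_eq_0) auto
      then show ?thesis by (simp add: 0)
    next
      case (Suc l)
      define y' where "y' = y(i := l)"
      have y: "y = y'(i := Suc (y' i))" using Suc by (simp add: y'_def fun_eq_iff)
      have v: "?v = urn_state a x\<^sub>0 y'"
        using urn_state_upd[of a x\<^sub>0 y' i] unfolding y[symmetric] by simp
      have sum': "sum y' UNIV = n"
        using Suc.prems sum_upd_Suc[of y' i] unfolding y[symmetric] by simp
      define R where "R = (\<Prod>k\<in>UNIV - {i}. polya_weight (x\<^sub>0 $ k / a) (y k))"
      have w: "w = polya_weight (x\<^sub>0 $ i / a) (Suc l) * R"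
        unfolding w_def R_def by (subst prod.remove[of _ i]) (auto simp: Suc)
      have R: "(\<Prod>k\<in>UNIV. polya_weight (x\<^sub>0 $ k / a) (y' k)) = polya_weight (x\<^sub>0 $ i / a) l * R"
        unfolding R_def by (subst prod.remove[of _ i]) (auto simp: y'_def)
      have "\<P>(\<omega> in M. X (Suc n) \<omega> = ?v + a *\<^sub>R axis i 1 \<and> X n \<omega> = ?v) =
          urn_state a x\<^sub>0 y' $ i / l1norm (urn_state a x\<^sub>0 y') * (polya_weight (x\<^sub>0 $ i / a) l * R / polya_weight A n)"
        unfolding prob_transition unfolding v Suc.IH[OF sum'] R A_def ..
      also have "urn_state a x\<^sub>0 y' $ i = a * (x\<^sub>0 $ i / a + real l)"
        using a by (simp add: urn_state_def y'_def field_simps)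
      also have "l1norm (urn_state a x\<^sub>0 y') = a * (A + real n)"
        using l1norm_urn_state[OF a x0, of y'] by (simp add: sum' A_def)
      also have "a * (x\<^sub>0 $ i / a + real l) / (a * (A + real n)) = (x\<^sub>0 $ i / a + real l) / (A + real n)"
        using a by simp
      finally show ?thesis
        by (simp add: w Suc polya_weight_Suc del: of_nat_Suc) 
    qed
  qed
  also have "\<dots> = w * real (Suc n) / ((A + real n) * polya_weight A n)"
    by (simp only: sum_divide_distrib[symmetric] sum_distrib_left[symmetric] of_nat_sum[symmetric] Suc.prems)
  also have "\<dots> = w / polya_weight A (Suc n)"
    by (simp add: polya_weight_Suc mult.commute)
  finally show ?case unfolding w_def A_def .
qed

lemma draw_count_measurable [measurable]: "draw_count a X n \<in> M \<rightarrow>\<^sub>M count_space UNIV"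
proof (subst measurable_count_space_eq2_countable, intro conjI ballI)
  fix y :: "'q \<Rightarrow> nat"
  have m: "(\<lambda>\<omega>. draw_count a X n \<omega> i) \<in> M \<rightarrow>\<^sub>M count_space UNIV" for i
    by (induction n) (simp_all add: draw_count_Suc)
  have "{\<omega>\<in>space M. \<forall>i. draw_count a X n \<omega> i = y i} \<in> events"
    using m by measurable
  also have "{\<omega>\<in>space M. \<forall>i. draw_count a X n \<omega> i = y i} = draw_count a X n -` {y} \<inter> space M"
    by (auto simp: fun_eq_iff)
  finally show "draw_count a X n -` {y} \<inter> space M \<in> events" .
qed auto

lemma prob_draw_count:
  assumes "sum y UNIV = n"
  shows "\<P>(\<omega> in M. draw_count a X n \<omega> = y) =
     (\<Prod>i\<in>UNIV. polya_weight (x\<^sub>0 $ i / a) (y i)) / polya_weight (\<Sum>i\<in>UNIV. x\<^sub>0 $ i / a) n"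
proof -
  have "\<P>(\<omega> in M. draw_count a X n \<omega> = y) = \<P>(\<omega> in M. X n \<omega> = urn_state a x\<^sub>0 y)"
  proof (rule prob_eq_AE)
    show "AE \<omega> in M. draw_count a X n \<omega> = y \<longleftrightarrow> X n \<omega> = urn_state a x\<^sub>0 y"
      using AE_urn_state[of n] by eventually_elim (use a urn_state_inj[of a x\<^sub>0] in auto)
  qed (simp, measurable)
  then show ?thesis using prob_urn_state[OF assms] by simp
qed

end

section \<open>The Dirichlet distribution on the hyperplane\<close>

definition complete_simplex :: "'q::finite \<Rightarrow> ('q \<Rightarrow> real) \<Rightarrow> real^'q" where
  "complete_simplex k y = (\<chi> i. if i = k then 1 - (\<Sum>j\<in>UNIV - {k}. y j) else y i)"

lemma complete_simplex_measurable [measurable]: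
  "complete_simplex k \<in> (\<Pi>\<^sub>M j\<in>UNIV - {k}. lborel) \<rightarrow>\<^sub>M borel"
proof -
  have comp: "(\<lambda>y. y i :: real) \<in> borel_measurable (\<Pi>\<^sub>M j\<in>UNIV - {k}. lborel)" if "i \<in> UNIV - {k}" for i
    using measurable_component_singleton[OF that, of "\<lambda>_. lborel :: real measure"] by simp
  have "(\<lambda>y. complete_simplex k y $ i) \<in> borel_measurable (\<Pi>\<^sub>M j\<in>UNIV - {k}. lborel)" for i
  proof (cases "i = k")
    case True
    have "(\<lambda>y. 1 - (\<Sum>j\<in>UNIV - {k}. y j) :: real) \<in> borel_measurable (\<Pi>\<^sub>M j\<in>UNIV - {k}. lborel)"
      using comp by (intro borel_measurable_diff borel_measurable_const borel_measurable_sum)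
    then show ?thesis by (simp add: True complete_simplex_def)
  next
    case False
    then show ?thesis using comp[of i] by (simp add: complete_simplex_def)
  qed
  then show ?thesis
    by (subst borel_measurable_euclidean_space) (auto simp: Basis_vec_def inner_axis)
qed

lemma sum_complete_simplex: "(\<Sum>i\<in>UNIV. complete_simplex k y $ i) = 1"
proof -
  have "(\<Sum>i\<in>UNIV. complete_simplex k y $ i) = complete_simplex k y $ k + (\<Sum>i\<in>UNIV - {k}. complete_simplex k y $ i)"
    by (rule sum.remove) auto
  then show ?thesis by (simp add: complete_simplex_def)
qed

lemma dirichlet_density_measurable [measurable]: "dirichlet_density v \<in> borel_measurable borel"
  unfolding dirichlet_density_def[abs_def] by measurable

lemma dirichlet_density_complete_simplex:
  "dirichlet_density v (complete_simplex k y) = simplex_density (\<lambda>i. v $ i) (v $ k) (UNIV - {k}) y"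
proof -
  have sum_v: "(\<Sum>i\<in>UNIV. v $ i) = (\<Sum>i\<in>UNIV - {k}. v $ i) + v $ k"
    by (subst sum.remove[of _ k]) auto
  have split: "(\<Prod>i\<in>UNIV. f i) = (\<Prod>i\<in>UNIV - {k}. f i) * f k" for f :: "_ \<Rightarrow> real"
    by (subst prod.remove[of _ k]) auto
  have "(\<Prod>i\<in>UNIV - {k}. complete_simplex k y $ i powr (v $ i - 1)) = (\<Prod>i\<in>UNIV - {k}. y i powr (v $ i - 1))"
    by (intro prod.cong) (auto simp: complete_simplex_def)
  moreover have "complete_simplex k y $ k = 1 - sum y (UNIV - {k})"
    by (simp add: complete_simplex_def)
  moreover have "(\<forall>i. 0 < complete_simplex k y $ i) \<longleftrightarrow> (\<forall>i\<in>UNIV - {k}. 0 < y i) \<and> sum y (UNIV - {k}) < 1"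
    by (auto simp: complete_simplex_def)
  ultimately show ?thesis
    unfolding dirichlet_density_def simplex_density_def sum_v split by simp
qed

lemma sets_dirichlet [measurable_cong]: "sets (dirichlet k v) = sets borel"
  by (simp add: dirichlet_def hyperplane_lborel_def)

lemma space_dirichlet [simp]: "space (dirichlet k v) = UNIV"
  by (simp add: dirichlet_def hyperplane_lborel_def)

lemma hyperplane_lborel_eq: "hyperplane_lborel k = distr (\<Pi>\<^sub>M j\<in>UNIV - {k}. lborel) borel (complete_simplex k)"
  by (simp add: hyperplane_lborel_def complete_simplex_def[abs_def])

lemma nn_integral_dirichlet:
  assumes [measurable]: "f \<in> borel_measurable borel"
  shows "(\<integral>\<^sup>+x. f x \<partial>dirichlet k v) =
    (\<integral>\<^sup>+y. ennreal (simplex_density (\<lambda>i. v $ i) (v $ k) (UNIV - {k}) y) * f (complete_simplex k y)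
       \<partial>(\<Pi>\<^sub>M j\<in>UNIV - {k}. lborel))"
  unfolding dirichlet_def hyperplane_lborel_eq
  by (subst nn_integral_density, measurable)
     (subst nn_integral_distr, measurable, simp add: dirichlet_density_complete_simplex)

lemma emeasure_dirichlet:
  assumes "A \<in> sets borel"
  shows "emeasure (dirichlet k v) A =
    (\<integral>\<^sup>+y. ennreal (simplex_density (\<lambda>i. v $ i) (v $ k) (UNIV - {k}) y) * indicator A (complete_simplex k y)
       \<partial>(\<Pi>\<^sub>M j\<in>UNIV - {k}. lborel))"
  using nn_integral_dirichlet[of "indicator A" k v] assms by (simp add: sets_dirichlet)

lemma AE_dirichlet:
  fixes v :: "real^'q"
  shows "AE x in dirichlet k v. (\<forall>i. 0 < x $ i) \<and> (\<Sum>i\<in>UNIV. x $ i) = 1"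
proof -
  have "{x. 0 < dirichlet_density v x \<longrightarrow> (\<forall>i. 0 < x $ i) \<and> (\<Sum>i\<in>UNIV. x $ i) = 1} \<in> sets (borel :: (real^'q) measure)"
    by measurable
  then show ?thesis
    unfolding dirichlet_def hyperplane_lborel_eq
    by (subst AE_density, measurable)
       (subst AE_distr_iff, auto simp: sum_complete_simplex, simp add: dirichlet_density_def split: if_splits)
qed

text \<open>Read off from the coupling at n = 0: inside the simplex all counts are then forced to be
  0, and the weight of the zero vector is 1.\<close>

lemma nn_integral_simplex_density:
  assumes "finite T" "\<And>i. i \<in> T \<Longrightarrow> 0 < \<alpha> i" "0 < \<gamma>"
  shows "(\<integral>\<^sup>+y. ennreal (simplex_density \<alpha> \<gamma> T y) \<partial>(\<Pi>\<^sub>M i\<in>T. lborel)) = 1"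
proof -
  obtain C \<Phi> where
    sum_le: "\<And>n y. (\<And>i. i \<in> T \<Longrightarrow> 0 < y i) \<Longrightarrow> sum y T < 1 \<Longrightarrow> sum (\<Phi> n y) T \<le> (n::nat)" and
    law: "\<And>n m. sum m T \<le> n \<Longrightarrow>
      (\<integral>\<^sup>+y. ennreal (simplex_density \<alpha> \<gamma> T y) * indicator {y. \<forall>i\<in>T. \<Phi> n y i = m i} y
         \<partial>(\<Pi>\<^sub>M i\<in>T. lborel)) = ennreal (dirichlet_multinomial \<alpha> \<gamma> T n m)"
    by (rule dirichlet_multinomial_coupling[OF assms]) blast+
  have "(\<integral>\<^sup>+y. ennreal (simplex_density \<alpha> \<gamma> T y) \<partial>(\<Pi>\<^sub>M i\<in>T. lborel)) =
    (\<integral>\<^sup>+y. ennreal (simplex_density \<alpha> \<gamma> T y) * indicator {y. \<forall>i\<in>T. \<Phi> 0 y i = 0} y \<partial>(\<Pi>\<^sub>M i\<in>T. lborel))"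
  proof (intro nn_integral_cong)
    fix y
    show "ennreal (simplex_density \<alpha> \<gamma> T y) = ennreal (simplex_density \<alpha> \<gamma> T y) * indicator {y. \<forall>i\<in>T. \<Phi> 0 y i = 0} y"
      using sum_le[of y 0] assms(1) by (auto simp: simplex_density_def indicator_def)
  qed
  also have "\<dots> = 1"
    using law[of "\<lambda>_. 0" 0] by (simp add: dirichlet_multinomial_def)
  finally show ?thesis .
qed

lemma prob_space_dirichlet:
  assumes "\<And>i. 0 < v $ i"
  shows "prob_space (dirichlet k v)"
proof
  show "emeasure (dirichlet k v) (space (dirichlet k v)) = 1"
    using emeasure_dirichlet[of UNIV k v] nn_integral_simplex_density[of "UNIV - {k}" "\<lambda>i. v $ i" "v $ k"] assms
    by simp
qed

text \<open>Stick breaking at j with a test function of y j alone; the inner integral is a total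
  mass 1. The coordinate j has to differ from k in order to be one of the integrated
  coordinates.\<close>

lemma emeasure_dirichlet_marginal:
  assumes v: "\<And>i. 0 < v $ i" and "j \<noteq> k" and A [measurable]: "A \<in> sets borel"
  shows "emeasure (dirichlet k v) {x. x $ j \<in> A} =
    emeasure (density lborel (\<lambda>b. ennreal (beta_density (v $ j) (\<Sum>i\<in>UNIV - {j}. v $ i) b))) A"
proof -
  define T where "T = UNIV - {k} - {j}"
  have T: "finite T" "j \<notin> T" "insert j T = UNIV - {k}" using \<open>j \<noteq> k\<close> by (auto simp: T_def)
  have sum: "(\<Sum>i\<in>T. v $ i) + v $ k = (\<Sum>i\<in>UNIV - {j}. v $ i)"
  proof -
    have "UNIV - {j} = insert k T" "k \<notin> T" using \<open>j \<noteq> k\<close> by (auto simp: T_def)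
    then show ?thesis by (simp add: T(1))
  qed
  have "emeasure (dirichlet k v) {x. x $ j \<in> A} =
    (\<integral>\<^sup>+y. ennreal (simplex_density (\<lambda>i. v $ i) (v $ k) (insert j T) y) * indicator A (y j) \<partial>(\<Pi>\<^sub>M j\<in>insert j T. lborel))"
    unfolding T(3) using \<open>j \<noteq> k\<close>
    by (subst emeasure_dirichlet) (auto simp: indicator_def complete_simplex_def intro!: nn_integral_cong)
  also have "\<dots> = (\<integral>\<^sup>+b. ennreal (beta_density (v $ j) ((\<Sum>i\<in>T. v $ i) + v $ k) b) *
      (\<integral>\<^sup>+z. ennreal (simplex_density (\<lambda>i. v $ i) (v $ k) T z) * indicator A b \<partial>(\<Pi>\<^sub>M j\<in>T. lborel)) \<partial>lborel)"
    by (intro nn_integral_simplex_density_insert[where G="\<lambda>b _. indicator A b"] T v) measurable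
  also have "\<dots> = (\<integral>\<^sup>+b. ennreal (beta_density (v $ j) ((\<Sum>i\<in>T. v $ i) + v $ k) b) * indicator A b \<partial>lborel)"
    using T(1) v by (intro nn_integral_cong) (auto simp: nn_integral_multc nn_integral_simplex_density)
  finally show ?thesis by (simp add: sum emeasure_density)
qed

text \<open>Transports the rounding map to vectors and gives the omitted colour k all draws that are
  left. The counts become a function of the Dirichlet point, so the coupling lives on the Dirichlet
  space itself.\<close>

lemma dirichlet_coupling:
  fixes v :: "real^'q"
  assumes v: "\<And>i. 0 < v $ i"
  obtains C \<Psi> where "0 \<le> C"
    and "\<And>n. \<Psi> n \<in> dirichlet k v \<rightarrow>\<^sub>M count_space (UNIV :: ('q \<Rightarrow> nat) set)"
    and "\<And>n. AE x in dirichlet k v. sum (\<Psi> n x) UNIV = n \<and> l1norm ((\<chi> i. real (\<Psi> n x i)) - real n *\<^sub>R x) \<le> C"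
    and "\<And>n m. sum m UNIV = n \<Longrightarrow> measure (dirichlet k v) {x. \<Psi> n x = m} =
        (\<Prod>i\<in>UNIV. polya_weight (v $ i) (m i)) / polya_weight (\<Sum>i\<in>UNIV. v $ i) n"
proof -
  define T where "T = UNIV - {k}"
  have kT: "k \<notin> T" "finite T" by (auto simp: T_def)
  have split: "sum f UNIV = f k + sum f T" for f :: "'q \<Rightarrow> 'c::comm_monoid_add"
    unfolding T_def by (rule sum.remove) auto
  obtain C \<Phi> where C: "0 \<le> C"
    and meas: "\<And>n i. i \<in> T \<Longrightarrow> (\<lambda>y. \<Phi> n y i) \<in> (\<Pi>\<^sub>M i\<in>T. lborel) \<rightarrow>\<^sub>M count_space (UNIV :: nat set)"
    and sum_le: "\<And>n y. (\<And>i. i \<in> T \<Longrightarrow> 0 < y i) \<Longrightarrow> sum y T < 1 \<Longrightarrow> sum (\<Phi> n y) T \<le> n"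
    and close: "\<And>n y i. (\<And>i. i \<in> T \<Longrightarrow> 0 < y i) \<Longrightarrow> sum y T < 1 \<Longrightarrow> i \<in> T \<Longrightarrow>
           \<bar>real (\<Phi> n y i) - real n * y i\<bar> \<le> C"
    and law: "\<And>n m. sum m T \<le> n \<Longrightarrow>
      (\<integral>\<^sup>+y. ennreal (simplex_density (\<lambda>i. v $ i) (v $ k) T y) * indicator {y. \<forall>i\<in>T. \<Phi> n y i = m i} y
         \<partial>(\<Pi>\<^sub>M i\<in>T. lborel)) = ennreal (dirichlet_multinomial (\<lambda>i. v $ i) (v $ k) T n m)"
    by (rule dirichlet_multinomial_coupling[of T "\<lambda>i. v $ i" "v $ k"]) (use v kT in blast)+
  define R where "R x = (\<lambda>i\<in>T. x $ i)" for x :: "real^'q"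
  define \<Psi> where "\<Psi> n x i = (if i = k then n - sum (\<Phi> n (R x)) T else \<Phi> n (R x) i)" for n x i
  have R_meas: "R \<in> borel \<rightarrow>\<^sub>M (\<Pi>\<^sub>M i\<in>T. lborel)"
    unfolding R_def by (intro measurable_restrict) simp
  have \<Phi>R [measurable]: "(\<lambda>x. \<Phi> n (R x) i) \<in> borel \<rightarrow>\<^sub>M count_space UNIV" if "i \<in> T" for n i
    by (rule measurable_compose[OF R_meas meas[OF that]])
  have comp: "(\<lambda>x. \<Psi> n x i) \<in> borel \<rightarrow>\<^sub>M count_space UNIV" for n i
  proof (cases "i = k")
    case True
    have "(\<lambda>x. n - sum (\<Phi> n (R x)) T) \<in> borel \<rightarrow>\<^sub>M count_space UNIV" by measurable
    then show ?thesis by (simp add: \<Psi>_def True)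
  next
    case False
    then show ?thesis using \<Phi>R[of i n] by (simp add: \<Psi>_def T_def)
  qed
  have \<Psi>_sets: "{x. \<Psi> n x = m} \<in> sets borel" for n m
  proof -
    have "{x \<in> space borel. \<forall>i. \<Psi> n x i = m i} \<in> sets borel"
      using comp by measurable
    then show ?thesis by (simp add: fun_eq_iff)
  qed
  have RE: "R (complete_simplex k y) = y" if "y \<in> space (\<Pi>\<^sub>M i\<in>T. lborel)" for y
    using that by (auto simp: R_def complete_simplex_def T_def space_PiM PiE_def extensional_def restrict_def fun_eq_iff)
  show thesis
  proof
    \<comment> \<open>The counts and n x have the same total n, so the error at k is minus the sum
      of the errors on T; this doubles their bound.\<close>
    show "0 \<le> 2 * (real CARD('q) * C)" using C by simp
    show "\<Psi> n \<in> dirichlet k v \<rightarrow>\<^sub>M count_space UNIV" for n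
      using \<Psi>_sets by (subst measurable_count_space_eq2_countable) (auto simp: vimage_def sets_dirichlet)
    show "AE x in dirichlet k v. sum (\<Psi> n x) UNIV = n \<and>
        l1norm ((\<chi> i. real (\<Psi> n x i)) - real n *\<^sub>R x) \<le> 2 * (real CARD('q) * C)" for n
      using AE_dirichlet
    proof eventually_elim
      case (elim x)
      have pos: "0 < R x i" if "i \<in> T" for i using that elim by (simp add: R_def)
      have sumR: "sum (R x) T = 1 - x $ k"
        using elim split[of "\<lambda>i. x $ i"] by (simp add: R_def)
      then have lt: "sum (R x) T < 1" using elim by simp
      have \<Psi>T: "\<Psi> n x i = \<Phi> n (R x) i" if "i \<in> T" for i
        using that kT by (auto simp: \<Psi>_def)
      have \<Psi>k: "\<Psi> n x k = n - sum (\<Phi> n (R x)) T" by (simp add: \<Psi>_def)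
      have le: "sum (\<Phi> n (R x)) T \<le> n" by (rule sum_le[OF pos lt])
      have "(\<Sum>i\<in>T. \<bar>real (\<Psi> n x i) - real n * x $ i\<bar>) \<le> (\<Sum>i\<in>T. C)"
      proof (intro sum_mono)
        fix i assume "i \<in> T"
        then show "\<bar>real (\<Psi> n x i) - real n * x $ i\<bar> \<le> C"
          using close[OF pos lt, of i n] by (simp add: \<Psi>T R_def)
      qed
      also have "\<dots> \<le> real CARD('q) * C"
        using C card_mono[of UNIV T] by (auto intro!: mult_right_mono)
      finally have 1: "(\<Sum>i\<in>T. \<bar>real (\<Psi> n x i) - real n * x $ i\<bar>) \<le> real CARD('q) * C" .
      have "real (\<Psi> n x k) - real n * x $ k = - (\<Sum>i\<in>T. real (\<Psi> n x i) - real n * x $ i)"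
      proof -
        have "real (\<Psi> n x k) = real n - (\<Sum>i\<in>T. real (\<Psi> n x i))"
          using le by (simp add: \<Psi>k \<Psi>T of_nat_diff)
        moreover have "x $ k = 1 - (\<Sum>i\<in>T. x $ i)"
          using sumR by (simp add: R_def)
        ultimately show ?thesis
          by (simp add: sum_subtractf right_diff_distrib flip: sum_distrib_left)
      qed
      then have "\<bar>real (\<Psi> n x k) - real n * x $ k\<bar> \<le> (\<Sum>i\<in>T. \<bar>real (\<Psi> n x i) - real n * x $ i\<bar>)"
        using sum_abs[of "\<lambda>i. real (\<Psi> n x i) - real n * x $ i" T] by simp
      then have "l1norm ((\<chi> i. real (\<Psi> n x i)) - real n *\<^sub>R x) \<le> 2 * (real CARD('q) * C)"
        using 1 by (simp add: l1norm_def split)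
      moreover have "sum (\<Psi> n x) UNIV = n"
        using le by (simp add: split \<Psi>k \<Psi>T)
      ultimately show ?case by simp
    qed
    fix n and m :: "'q \<Rightarrow> nat" assume m: "sum m UNIV = n"
    then have mT: "sum m T \<le> n" "m k = n - sum m T" by (auto simp: split)
    have "emeasure (dirichlet k v) {x. \<Psi> n x = m} =
      (\<integral>\<^sup>+y. ennreal (simplex_density (\<lambda>i. v $ i) (v $ k) T y) * indicator {y. \<forall>i\<in>T. \<Phi> n y i = m i} y
         \<partial>(\<Pi>\<^sub>M i\<in>T. lborel))"
    proof (subst emeasure_dirichlet[OF \<Psi>_sets], unfold T_def[symmetric], intro nn_integral_cong)
      fix y :: "'q \<Rightarrow> real" assume y: "y \<in> space (\<Pi>\<^sub>M i\<in>T. lborel)"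
      have "\<Psi> n (complete_simplex k y) = m \<longleftrightarrow> (\<forall>i\<in>T. \<Phi> n y i = m i)"
      proof
        assume "\<forall>i\<in>T. \<Phi> n y i = m i"
        moreover from this have "sum (\<Phi> n y) T = sum m T" by simp
        ultimately show "\<Psi> n (complete_simplex k y) = m"
          using mT by (auto simp: \<Psi>_def RE[OF y] fun_eq_iff T_def)
      next
        assume *: "\<Psi> n (complete_simplex k y) = m"
        show "\<forall>i\<in>T. \<Phi> n y i = m i"
        proof
          fix i assume "i \<in> T"
          then show "\<Phi> n y i = m i"
            using fun_cong[OF *, of i] kT by (auto simp: \<Psi>_def RE[OF y] split: if_splits)
        qed
      qed
      then show "ennreal (simplex_density (\<lambda>i. v $ i) (v $ k) T y) * indicator {x. \<Psi> n x = m} (complete_simplex k y) =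
        ennreal (simplex_density (\<lambda>i. v $ i) (v $ k) T y) * indicator {y. \<forall>i\<in>T. \<Phi> n y i = m i} y"
        by (simp add: indicator_def)
    qed
    also have "\<dots> = ennreal (dirichlet_multinomial (\<lambda>i. v $ i) (v $ k) T n m)"
      by (rule law[OF mT(1)])
    also have "dirichlet_multinomial (\<lambda>i. v $ i) (v $ k) T n m =
        (\<Prod>i\<in>UNIV. polya_weight (v $ i) (m i)) / polya_weight (\<Sum>i\<in>UNIV. v $ i) n"
    proof -
      have "(\<Prod>i\<in>UNIV. polya_weight (v $ i) (m i)) = polya_weight (v $ k) (m k) * (\<Prod>i\<in>T. polya_weight (v $ i) (m i))"
        unfolding T_def by (rule prod.remove) auto
      then show ?thesis
        by (simp add: dirichlet_multinomial_def split mT(2) mult.commute add.commute)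
    qed
    finally show "measure (dirichlet k v) {x. \<Psi> n x = m} =
        (\<Prod>i\<in>UNIV. polya_weight (v $ i) (m i)) / polya_weight (\<Sum>i\<in>UNIV. v $ i) n"
      using v by (simp add: measure_def prod_nonneg sum_nonneg polya_weight_pos less_imp_le sum_pos)
  qed
qed

section \<open>The minimal \<open>L\<^sub>p\<close> distance\<close>

lemma ennreal_powr_ennreal: "0 \<le> t \<Longrightarrow> ennreal_powr (ennreal t) s = ennreal (t powr s)"
  by (simp add: ennreal_powr_def)

lemma ennreal_powr_mono:
  assumes "x \<le> y" "0 \<le> s"
  shows "ennreal_powr x s \<le> ennreal_powr y s"
proof (cases "y = \<infinity>")
  case False
  then have "y < top" "x < top" using assms(1) by (auto simp: less_top intro: le_less_trans)
  then show ?thesis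
    using assms by (auto simp: ennreal_powr_def intro!: ennreal_leI powr_mono2 enn2real_mono)
qed (simp add: ennreal_powr_def)

lemma (in prob_space) Lp_norm_le:
  assumes p: "1 \<le> p" and Z [measurable]: "Z \<in> borel_measurable M" and B: "0 \<le> B"
    and AE: "AE \<omega> in M. l1norm (Z \<omega>) \<le> B"
  shows "Lp_norm p M Z \<le> ennreal B"
proof (cases "p = \<infinity>")
  case True
  have "esssup M (\<lambda>\<omega>. ennreal (l1norm (Z \<omega>))) \<le> ennreal B"
    using AE by (intro esssup_I) (auto intro: ennreal_leI)
  then show ?thesis by (simp add: Lp_norm_def True)
next
  case False
  define q where "q = enn2real p"
  have q: "1 \<le> q" using p False unfolding q_def by (cases p) auto
  have "(\<integral>\<^sup>+\<omega>. ennreal (l1norm (Z \<omega>) powr q) \<partial>M) \<le> (\<integral>\<^sup>+\<omega>. ennreal (B powr q) \<partial>M)"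
    using AE q by (intro nn_integral_mono_AE)
      (auto intro!: ennreal_leI powr_mono2 sum_nonneg simp: l1norm_def)
  also have "\<dots> = ennreal (B powr q)" by (simp add: emeasure_space_1)
  finally have "Lp_norm p M Z \<le> ennreal_powr (ennreal (B powr q)) (1 / q)"
    using False q by (simp add: Lp_norm_def q_def[symmetric] ennreal_powr_mono)
  also have "\<dots> = ennreal B"
    using B q by (simp add: ennreal_powr_ennreal powr_powr)
  finally show ?thesis .
qed

text \<open>For a finite exponent q, Markov's inequality gives r times \<rho> powr (1 / q). Since
  \<rho> \<le> 1 \<le> q, this is at least \<rho> * r, a bound free of the exponent.\<close>

lemma (in prob_space) Lp_norm_ge:
  assumes p: "1 \<le> p" and Z [measurable]: "Z \<in> borel_measurable M" and r: "0 \<le> r"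
    and \<rho>: "0 < \<rho>" "\<rho> \<le> \<P>(\<omega> in M. r \<le> l1norm (Z \<omega>))"
  shows "ennreal (\<rho> * r) \<le> Lp_norm p M Z"
proof -
  have \<rho>1: "\<rho> \<le> 1" using \<rho>(2) prob_le_1 by (rule order_trans)
  show ?thesis
  proof (cases "p = \<infinity>")
    case True
    have "ennreal r \<le> esssup M (\<lambda>\<omega>. ennreal (l1norm (Z \<omega>)))"
    proof (rule ccontr)
      assume *: "\<not> ennreal r \<le> esssup M (\<lambda>\<omega>. ennreal (l1norm (Z \<omega>)))"
      have "AE \<omega> in M. \<not> r \<le> l1norm (Z \<omega>)"
        using esssup_AE[of "\<lambda>\<omega>. ennreal (l1norm (Z \<omega>))" M]
      proof eventually_elim
        case (elim \<omega>)
        show ?case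
        proof
          assume "r \<le> l1norm (Z \<omega>)"
          then have "ennreal r \<le> ennreal (l1norm (Z \<omega>))" by (rule ennreal_leI)
          with elim * show False by (meson order_trans)
        qed
      qed
      then have "\<P>(\<omega> in M. r \<le> l1norm (Z \<omega>)) = 0"
        by (subst prob_Collect_eq_0) auto
      with \<rho> show False by simp
    qed
    moreover have "\<rho> * r \<le> r"
      using r \<rho>(1) \<rho>1 by (intro mult_left_le_one_le) auto
    ultimately show ?thesis
      by (simp add: Lp_norm_def True) (meson ennreal_leI order_trans)
  next
    case False
    define q where "q = enn2real p"
    have q: "1 \<le> q" using p False unfolding q_def by (cases p) auto
    let ?E = "{\<omega>\<in>space M. r \<le> l1norm (Z \<omega>)}"
    have "ennreal (r powr q * \<rho>) \<le> ennreal (r powr q) * emeasure M ?E"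
      using \<rho> by (simp add: ennreal_mult emeasure_eq_measure mult_left_mono ennreal_leI)
    also have "\<dots> = (\<integral>\<^sup>+\<omega>. ennreal (r powr q) * indicator ?E \<omega> \<partial>M)"
      by (simp add: nn_integral_cmult)
    also have "\<dots> \<le> (\<integral>\<^sup>+\<omega>. ennreal (l1norm (Z \<omega>) powr q) \<partial>M)"
      using r q by (intro nn_integral_mono) (auto simp: indicator_def intro!: ennreal_leI powr_mono2)
    finally have "ennreal_powr (ennreal (r powr q * \<rho>)) (1 / q) \<le> Lp_norm p M Z"
      using False q by (simp add: Lp_norm_def q_def[symmetric] ennreal_powr_mono)
    moreover have "ennreal_powr (ennreal (r powr q * \<rho>)) (1 / q) = ennreal (r * \<rho> powr (1 / q))"
      using r q \<rho> by (simp add: ennreal_powr_ennreal powr_mult powr_powr)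
    moreover have "\<rho> powr 1 \<le> \<rho> powr (1 / q)"
      using \<rho>1 \<rho>(1) q by (intro powr_mono') auto
    then have "ennreal (\<rho> * r) \<le> ennreal (r * \<rho> powr (1 / q))"
      using mult_left_mono[of \<rho> "\<rho> powr (1 / q)" r] r \<rho>(1) by (intro ennreal_leI) (simp add: mult.commute[of \<rho> r])
    ultimately show ?thesis by simp
  qed
qed

section \<open>Lower bound: a beta variable stays away from small finite sets\<close>

lemma beta_avoids_finite_set:
  assumes \<alpha>: "0 < \<alpha>" and \<beta>: "0 < \<beta>"
  obtains \<rho> \<epsilon> where "0 < \<rho>" "0 < \<epsilon>"
    "\<And>n L. 1 \<le> n \<Longrightarrow> finite L \<Longrightarrow> card L \<le> 2 * n \<Longrightarrow>
       ennreal \<rho> \<le> emeasure (density lborel (\<lambda>b. ennreal (beta_density \<alpha> \<beta> b))) {b. \<forall>t\<in>L. \<epsilon> / real n \<le> \<bar>b - t\<bar>}"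
proof -
  define P where "P = density lborel (\<lambda>b. ennreal (beta_density \<alpha> \<beta> b))"
  have sets_P [measurable_cong]: "sets P = sets borel" by (simp add: P_def)
  have P_le: "emeasure P {..u} = ennreal (beta_cdf \<alpha> \<beta> u)" if "0 \<le> u" "u \<le> 1" for u
    using nn_integral_beta_density[OF \<alpha> \<beta> that] by (simp add: P_def emeasure_density)
  define S where "S = {1/4<..3/4::real}"
  define d where "d = beta_cdf \<alpha> \<beta> (3/4) - beta_cdf \<alpha> \<beta> (1/4)"
  have d: "0 < d" unfolding d_def using beta_cdf_strict_mono[OF \<alpha> \<beta>, of "1/4" "3/4"] by simp
  have S: "emeasure P S = ennreal d"
  proof -
    have "0 \<le> beta_cdf \<alpha> \<beta> (1/4)"
      using monoD[OF mono_beta_cdf[OF \<alpha> \<beta>], of 0 "1/4"] \<alpha> \<beta> by simp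
    moreover have "S = {..3/4} - {..1/4}" by (auto simp: S_def)
    ultimately show ?thesis
      using P_le[of "1/4"] P_le[of "3/4"]
      by (simp add: emeasure_Diff sets_P d_def ennreal_minus)
  qed
  have "continuous_on {1/4..3/4} (\<lambda>x. x powr (\<alpha> - 1) * (1 - x) powr (\<beta> - 1) / Beta \<alpha> \<beta>)"
    using Beta_real_pos[OF \<alpha> \<beta>] by (intro continuous_intros) auto
  then have "bounded ((\<lambda>x. x powr (\<alpha> - 1) * (1 - x) powr (\<beta> - 1) / Beta \<alpha> \<beta>) ` {1/4..3/4})"
    by (intro compact_imp_bounded compact_continuous_image) auto
  then obtain K where K: "0 < K" "\<And>x. x \<in> {1/4..3/4} \<Longrightarrow> \<bar>x powr (\<alpha> - 1) * (1 - x) powr (\<beta> - 1) / Beta \<alpha> \<beta>\<bar> \<le> K"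
    unfolding bounded_pos by auto
  have dens_le: "beta_density \<alpha> \<beta> x \<le> K" if "x \<in> S" for x
    using K(2)[of x] that Beta_real_pos[OF \<alpha> \<beta>] by (auto simp: beta_density_def S_def abs_le_iff)
  \<comment> \<open>At most 2 n intervals of length 2 \<epsilon> / n, with density at most K on S,
    have mass at most 4 K \<epsilon> = d / 2. This leaves d / 2 of the mass d of S.\<close>
  define \<epsilon> where "\<epsilon> = d / (8 * K)"
  have \<epsilon>: "0 < \<epsilon>" using d K by (simp add: \<epsilon>_def)
  have interval: "emeasure P (S \<inter> {b. \<bar>b - t\<bar> < r}) \<le> ennreal (K * (2 * r))" if "0 < r" for t r
  proof -
    have eq: "{b. \<bar>b - t\<bar> < r} = {t - r<..<t + r}" by auto
    have "emeasure P (S \<inter> {b. \<bar>b - t\<bar> < r}) = (\<integral>\<^sup>+b. ennreal (beta_density \<alpha> \<beta> b) * indicator (S \<inter> {t - r<..<t + r}) b \<partial>lborel)"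
      unfolding P_def eq by (subst emeasure_density) (auto simp: S_def)
    also have "\<dots> \<le> (\<integral>\<^sup>+b. ennreal K * indicator {t - r<..<t + r} b \<partial>lborel)"
      by (intro nn_integral_mono) (auto simp: indicator_def intro!: ennreal_leI dens_le)
    also have "\<dots> = ennreal (K * (2 * r))"
      using that K(1) by (simp add: nn_integral_cmult ennreal_mult)
    finally show ?thesis .
  qed
  show thesis
  proof
    show "0 < d / 2" "0 < \<epsilon>" using d \<epsilon> by auto
    fix n :: nat and L :: "real set" assume n: "1 \<le> n" and L: "finite L" "card L \<le> 2 * n"
    define r where "r = \<epsilon> / real n"
    have r: "0 < r" using \<epsilon> n by (simp add: r_def)
    let ?G = "{b. \<forall>t\<in>L. r \<le> \<bar>b - t\<bar>}"
    have G: "?G \<in> sets P"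
    proof -
      have "?G = (\<Inter>t\<in>L. {b. r \<le> \<bar>b - t\<bar>}) \<inter> UNIV" by auto
      moreover have "{b. r \<le> \<bar>b - t\<bar>} \<in> sets P" for t unfolding sets_P by measurable
      ultimately show ?thesis using L(1) by (cases "L = {}") (auto simp: sets_P)
    qed
    have "ennreal d = emeasure P S" by (simp add: S)
    also have "\<dots> \<le> emeasure P (?G \<union> (\<Union>t\<in>L. S \<inter> {b. \<bar>b - t\<bar> < r}))"
      using G L(1) by (intro emeasure_mono) (auto simp: not_le sets_P S_def)
    also have "\<dots> \<le> emeasure P ?G + emeasure P (\<Union>t\<in>L. S \<inter> {b. \<bar>b - t\<bar> < r})"
      using G L(1) by (intro emeasure_subadditive) (auto simp: sets_P S_def)
    also have "emeasure P (\<Union>t\<in>L. S \<inter> {b. \<bar>b - t\<bar> < r}) \<le> (\<Sum>t\<in>L. emeasure P (S \<inter> {b. \<bar>b - t\<bar> < r}))"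
      using L(1) by (intro emeasure_subadditive_finite) (auto simp: sets_P S_def)
    also have "\<dots> \<le> (\<Sum>t\<in>L. ennreal (K * (2 * r)))"
      by (intro sum_mono interval r)
    also have "\<dots> = ennreal (real (card L) * (K * (2 * r)))"
      using K r by (simp add: ennreal_mult ennreal_of_nat_eq_real_of_nat)
    also have "\<dots> \<le> ennreal (real (2 * n) * (K * (2 * r)))"
      using L(2) K r by (intro ennreal_leI mult_right_mono) auto
    also have "real (2 * n) * (K * (2 * r)) = d / 2"
      using n K by (simp add: r_def \<epsilon>_def)
    finally have *: "ennreal d \<le> emeasure P ?G + ennreal (d / 2)"
      by (simp add: add_left_mono)
    have "ennreal (d / 2) + ennreal (d / 2) = ennreal d"
      using d by (simp flip: ennreal_plus)
    with * have "ennreal (d / 2) + ennreal (d / 2) \<le> ennreal (d / 2) + emeasure P ?G"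
      by (simp add: add.commute)
    then show "ennreal (d / 2) \<le> emeasure (density lborel (\<lambda>b. ennreal (beta_density \<alpha> \<beta> b))) {b. \<forall>t\<in>L. \<epsilon> / real n \<le> \<bar>b - t\<bar>}"
      unfolding r_def P_def by (simp add: ennreal_add_left_cancel_le)
  qed
qed

text \<open>Both facts used, that X' $ j lies in L and that Y' $ j avoids a neighbourhood of L with
  probability at least \<rho>, concern one marginal each. So the estimate holds under every
  coupling, with c = \<rho> * \<epsilon>, and the beta marginal does not involve k.\<close>

lemma lp_dist_lattice_dirichlet_ge:
  fixes v :: "real^'q" and j :: 'q
  assumes v: "\<And>i. 0 < v $ i" and "CARD('q) \<ge> 2"
  obtains c where "0 < c"
    "\<And>k \<mu> L n p. j \<noteq> k \<Longrightarrow> 1 \<le> n \<Longrightarrow> 1 \<le> p \<Longrightarrow> finite L \<Longrightarrow> card L \<le> 2 * n \<Longrightarrow> (AE x in \<mu>. x $ j \<in> L) \<Longrightarrow> sets \<mu> = sets borel \<Longrightarrow>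
       ennreal (c / real n) \<le> lp_dist p \<mu> (dirichlet k v)"
proof -
  have "UNIV - {j} \<noteq> {}"
  proof
    assume "UNIV - {j} = {}"
    then have "(UNIV :: 'q set) = {j}" by auto
    then have "CARD('q) = card {j}" by (rule arg_cong)
    with assms(2) show False by simp
  qed
  then have pos: "0 < (\<Sum>i\<in>UNIV - {j}. v $ i)" using v by (intro sum_pos) auto
  obtain \<rho> \<epsilon> where \<rho>: "0 < \<rho>" and \<epsilon>: "0 < \<epsilon>"
    and avoid: "\<And>n L. 1 \<le> n \<Longrightarrow> finite L \<Longrightarrow> card L \<le> 2 * n \<Longrightarrow>
       ennreal \<rho> \<le> emeasure (density lborel (\<lambda>b. ennreal (beta_density (v $ j) (\<Sum>i\<in>UNIV - {j}. v $ i) b)))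
          {b. \<forall>t\<in>L. \<epsilon> / real n \<le> \<bar>b - t\<bar>}"
    by (rule beta_avoids_finite_set[OF v[of j] pos]) blast
  show thesis
  proof
    show "0 < \<rho> * \<epsilon>" using \<rho> \<epsilon> by simp
    fix k :: 'q and \<mu> :: "(real^'q) measure" and L n and p :: ennreal
    assume "j \<noteq> k" and n: "1 \<le> (n::nat)" and p: "1 \<le> p" and L: "finite L" "card L \<le> 2 * n"
      and \<mu>: "AE x in \<mu>. x $ j \<in> L" "sets \<mu> = sets borel"
    show "ennreal (\<rho> * \<epsilon> / real n) \<le> lp_dist p \<mu> (dirichlet k v)"
      unfolding lp_dist_def
    proof (rule Inf_greatest, clarify)
      fix M :: "((real^'q) \<times> (real^'q)) measure" and X' Y' :: "(real^'q) \<times> (real^'q) \<Rightarrow> real^'q"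
      assume "prob_space M" and X[measurable]: "X' \<in> borel_measurable M" and Y[measurable]: "Y' \<in> borel_measurable M"
        and eq: "distr M borel Y' = dirichlet k v" and \<mu>_eq: "\<mu> = distr M borel X'"
      interpret prob_space M by fact
      define G where "G = {b. \<forall>t\<in>L. \<epsilon> / real n \<le> \<bar>b - t\<bar>}"
      have G [measurable]: "G \<in> sets borel"
      proof -
        have "G = (\<Inter>t\<in>L. {b. \<epsilon> / real n \<le> \<bar>b - t\<bar>}) \<inter> UNIV" by (auto simp: G_def)
        moreover have "{b. \<epsilon> / real n \<le> \<bar>b - t\<bar>} \<in> sets borel" for t by measurable
        ultimately show ?thesis using L(1) by (cases "L = {}") auto
      qed
      have Gj: "{x. x $ j \<in> G} \<in> sets (borel :: (real^'q) measure)" by measurable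
      have "(\<Union>t\<in>L. {x. x $ j = t}) \<in> sets (borel :: (real^'q) measure)"
        by (intro sets.finite_UN L(1)) measurable
      also have "(\<Union>t\<in>L. {x. x $ j = t}) = {x :: real^'q. x $ j \<in> L}" by auto
      finally have AE: "AE \<omega> in M. X' \<omega> $ j \<in> L"
        using \<mu>(1) unfolding \<mu>_eq by (subst (asm) AE_distr_iff) auto
      have "ennreal \<rho> \<le> emeasure (dirichlet k v) {x. x $ j \<in> G}"
        using avoid[OF n L] emeasure_dirichlet_marginal[OF v \<open>j \<noteq> k\<close> G] by (simp add: G_def)
      also have "\<dots> = emeasure M {\<omega>\<in>space M. Y' \<omega> $ j \<in> G}"
        unfolding eq[symmetric] using Gj by (subst emeasure_distr) (auto simp: vimage_def Int_def conj_commute)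
      also have "\<dots> \<le> emeasure M {\<omega>\<in>space M. \<epsilon> / real n \<le> l1norm (X' \<omega> - Y' \<omega>)}"
      proof (rule emeasure_mono_AE)
        show "AE \<omega> in M. \<omega> \<in> {\<omega>\<in>space M. Y' \<omega> $ j \<in> G} \<longrightarrow> \<omega> \<in> {\<omega>\<in>space M. \<epsilon> / real n \<le> l1norm (X' \<omega> - Y' \<omega>)}"
          using AE
        proof eventually_elim
          case (elim \<omega>)
          have "\<bar>Y' \<omega> $ j - X' \<omega> $ j\<bar> \<le> l1norm (X' \<omega> - Y' \<omega>)"
            using member_le_sum[of j UNIV "\<lambda>i. \<bar>(X' \<omega> - Y' \<omega>) $ i\<bar>"]
            by (simp add: l1norm_def abs_minus_commute)
          with elim show ?case by (auto simp: G_def intro: order_trans)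
        qed
      qed measurable
      finally have "\<rho> \<le> \<P>(\<omega> in M. \<epsilon> / real n \<le> l1norm (X' \<omega> - Y' \<omega>))"
        using \<rho> by (simp add: emeasure_eq_measure)
      then have "ennreal (\<rho> * (\<epsilon> / real n)) \<le> Lp_norm p M (\<lambda>\<omega>. X' \<omega> - Y' \<omega>)"
        using \<epsilon> n \<rho> by (intro Lp_norm_ge p) auto
      then show "ennreal (\<rho> * \<epsilon> / real n) \<le> Lp_norm p M (\<lambda>\<omega>. X' \<omega> - Y' \<omega>)" by simp
    qed
  qed
qed

section \<open>Transfer of the coupling to the urn\<close>

context polya_urn_process
begin

text \<open>The coupling is the pair (g (\<Psi> x), x) on the space \<nu>. Its first component has
  the law of f, because \<Psi> under \<nu> has the law of the draw counts.\<close>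

lemma lp_dist_urn_le:
  assumes \<nu>: "prob_space \<nu>" and sets_\<nu>: "sets \<nu> = sets borel"
    and \<Psi>: "\<Psi> \<in> \<nu> \<rightarrow>\<^sub>M count_space (UNIV :: ('q \<Rightarrow> nat) set)"
    and \<Psi>_sum: "AE x in \<nu>. sum (\<Psi> x) UNIV = n"
    and law: "\<And>m. sum m UNIV = n \<Longrightarrow> measure \<nu> {x. \<Psi> x = m} =
        (\<Prod>i\<in>UNIV. polya_weight (x\<^sub>0 $ i / a) (m i)) / polya_weight (\<Sum>i\<in>UNIV. x\<^sub>0 $ i / a) n"
    and f: "f \<in> borel_measurable M" "AE \<omega> in M. f \<omega> = g (draw_count a X n \<omega>)"
    and g: "AE x in \<nu>. l1norm (g (\<Psi> x) - x) \<le> B" and "0 \<le> B" "1 \<le> p"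
  shows "lp_dist p (distr M borel f) \<nu> \<le> ennreal B"
proof -
  interpret \<nu>: prob_space \<nu> by fact
  have [measurable]: "g \<in> count_space UNIV \<rightarrow>\<^sub>M borel" by simp
  note \<Psi>[measurable]
  have space_\<nu>: "space \<nu> = UNIV" using sets_eq_imp_space_eq[OF sets_\<nu>] by simp
  \<comment> \<open>Both laws live on the countable set of count vectors with total n, so agreement
    on singletons suffices.\<close>
  have "distr M (count_space UNIV) (draw_count a X n) = distr \<nu> (count_space UNIV) \<Psi>"
  proof (rule measure_eqI_countable_AE)
    show "AE y in distr M (count_space UNIV) (draw_count a X n). y \<in> {y. sum y UNIV = n}"
      using AE_urn_state[of n] by (subst AE_distr_iff) auto
    show "AE y in distr \<nu> (count_space UNIV) \<Psi>. y \<in> {y. sum y UNIV = n}"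
      using \<Psi>_sum by (subst AE_distr_iff) auto
    fix y :: "'q \<Rightarrow> nat" assume y: "y \<in> {y. sum y UNIV = n}"
    have "emeasure (distr M (count_space UNIV) (draw_count a X n)) {y} = ennreal (\<P>(\<omega> in M. draw_count a X n \<omega> = y))"
      by (subst emeasure_distr) (auto simp: emeasure_eq_measure vimage_def Int_def conj_commute)
    moreover have "emeasure (distr \<nu> (count_space UNIV) \<Psi>) {y} = ennreal (measure \<nu> {x. \<Psi> x = y})"
      by (subst emeasure_distr) (auto simp: \<nu>.emeasure_eq_measure vimage_def space_\<nu>)
    ultimately show "emeasure (distr M (count_space UNIV) (draw_count a X n)) {y} = emeasure (distr \<nu> (count_space UNIV) \<Psi>) {y}"
      using prob_draw_count[of y n] law[of y] y by simp
  qed auto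
  then have "distr M borel (\<lambda>\<omega>. g (draw_count a X n \<omega>)) = distr \<nu> borel (\<lambda>x. g (\<Psi> x))"
    using distr_distr[of g "count_space UNIV" borel "draw_count a X n" M] distr_distr[of g "count_space UNIV" borel \<Psi> \<nu>]
    by (simp add: comp_def)
  moreover have "distr M borel f = distr M borel (\<lambda>\<omega>. g (draw_count a X n \<omega>))"
    using f by (intro distr_cong_AE) auto
  moreover have "distr \<nu> borel (\<lambda>x. x) = \<nu>"
    by (rule distr_id2[OF sets_\<nu>[symmetric]])
  moreover have id: "(\<lambda>x. x) \<in> borel_measurable \<nu>"
    using measurable_ident_sets[OF sets_\<nu>] by (simp add: id_def)
  moreover have "lp_dist p (distr \<nu> borel (\<lambda>x. g (\<Psi> x))) (distr \<nu> borel (\<lambda>x. x)) \<le> Lp_norm p \<nu> (\<lambda>x. g (\<Psi> x) - x)"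
    using id by (intro lp_dist_le \<nu>) measurable
  moreover have "Lp_norm p \<nu> (\<lambda>x. g (\<Psi> x) - x) \<le> ennreal B"
    using id g assms(9,10) by (intro \<nu>.Lp_norm_le) auto
  ultimately show ?thesis by simp
qed

end

lemma l1norm_scaleR: "l1norm (c *\<^sub>R x) = \<bar>c\<bar> * l1norm x"
  by (simp add: l1norm_def abs_mult sum_distrib_left)

text \<open>Divided by \<open>a\<close>, the state is x0 / a + y with total S + n. Subtracting x
  leaves the numerator x0 / a - S x plus the count error y - n x, of norm at most 2 S + C, and S + n
  \<ge> n.\<close>

lemma normalized_urn_state_close:
  assumes a: "a > 0" and x0: "\<And>i. x\<^sub>0 $ i > 0" and n: "1 \<le> n" and y: "sum y UNIV = n"
    and x: "\<And>i. 0 < x $ i" "(\<Sum>i\<in>UNIV. x $ i) = 1"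
    and C: "l1norm ((\<chi> i. real (y i)) - real n *\<^sub>R x) \<le> C"
  shows "l1norm ((1 / l1norm (urn_state a x\<^sub>0 y)) *\<^sub>R urn_state a x\<^sub>0 y - x) \<le>
    (C + 2 * (\<Sum>i\<in>UNIV. x\<^sub>0 $ i / a)) / real n"
proof -
  define S where "S = (\<Sum>i\<in>UNIV. x\<^sub>0 $ i / a)"
  have S: "0 \<le> S" unfolding S_def using a x0 by (intro sum_nonneg) (auto simp: less_imp_le)
  have norm: "l1norm (urn_state a x\<^sub>0 y) = a * (S + real n)"
    using l1norm_urn_state[OF a x0, of y] unfolding y S_def .
  have "((1 / l1norm (urn_state a x\<^sub>0 y)) *\<^sub>R urn_state a x\<^sub>0 y - x) $ i =
      (x\<^sub>0 $ i / a - S * x $ i + (real (y i) - real n * x $ i)) / (S + real n)" for i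
  proof -
    define D where "D = S + real n"
    have D: "0 < D" using n S by (simp add: D_def)
    have "((1 / l1norm (urn_state a x\<^sub>0 y)) *\<^sub>R urn_state a x\<^sub>0 y - x) $ i = (x\<^sub>0 $ i + a * real (y i)) / (a * D) - x $ i"
      unfolding norm by (simp add: urn_state_def D_def)
    also have "(x\<^sub>0 $ i + a * real (y i)) / (a * D) = (x\<^sub>0 $ i / a + real (y i)) / D"
      using a by (simp add: add_divide_distrib)
    also have "(x\<^sub>0 $ i / a + real (y i)) / D - x $ i = (x\<^sub>0 $ i / a + real (y i) - D * x $ i) / D"
      using D by (simp add: diff_divide_distrib)
    also have "x\<^sub>0 $ i / a + real (y i) - D * x $ i = x\<^sub>0 $ i / a - S * x $ i + (real (y i) - real n * x $ i)"
      by (simp add: D_def algebra_simps)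
    finally show ?thesis unfolding D_def .
  qed
  moreover have "\<bar>(x\<^sub>0 $ i / a - S * x $ i + (real (y i) - real n * x $ i)) / (S + real n)\<bar> \<le>
      (x\<^sub>0 $ i / a + S * x $ i + \<bar>real (y i) - real n * x $ i\<bar>) / real n" for i
  proof -
    have "0 \<le> x\<^sub>0 $ i / a" "0 \<le> S * x $ i" using a x0[of i] S x(1)[of i] by auto
    then have "\<bar>x\<^sub>0 $ i / a - S * x $ i + (real (y i) - real n * x $ i)\<bar> \<le>
      x\<^sub>0 $ i / a + S * x $ i + \<bar>real (y i) - real n * x $ i\<bar>" by linarith
    then show ?thesis
      unfolding abs_divide using n S by (intro frac_le) auto
  qed
  ultimately have "l1norm ((1 / l1norm (urn_state a x\<^sub>0 y)) *\<^sub>R urn_state a x\<^sub>0 y - x) \<le>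
     (\<Sum>i\<in>UNIV. (x\<^sub>0 $ i / a + S * x $ i + \<bar>real (y i) - real n * x $ i\<bar>) / real n)"
    unfolding l1norm_def[of "_ - x"] by (intro sum_mono) simp
  also have "\<dots> = (S + S * (\<Sum>i\<in>UNIV. x $ i) + l1norm ((\<chi> i. real (y i)) - real n *\<^sub>R x)) / real n"
    by (simp add: l1norm_def S_def sum.distrib flip: sum_divide_distrib sum_distrib_left)
  also have "\<dots> \<le> (C + 2 * S) / real n"
    using C n x(2) by (intro divide_right_mono) auto
  finally show ?thesis unfolding S_def .
qed

theorem theorem1p2:
  fixes a :: real and x\<^sub>0 :: "real^'q"
  assumes "CARD('q) \<ge> 2" and "a > 0" and "\<And>i. x\<^sub>0 $ i > 0"
  shows "\<exists>c C :: real. 0 < c \<and> c \<le> C \<and>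
    (\<forall>(M :: 'w measure) X (k :: 'q) (p :: ennreal) (n :: nat).
       polya_urn M a x\<^sub>0 X \<longrightarrow> 1 \<le> p \<longrightarrow> 1 \<le> n \<longrightarrow>
         (let W = dirichlet k ((1 / a) *\<^sub>R x\<^sub>0);
              d\<^sub>X = lp_dist p (distr M borel (\<lambda>\<omega>. (1 / l1norm (X n \<omega>)) *\<^sub>R X n \<omega>)) W;
              d\<^sub>Y = lp_dist p (distr M borel (\<lambda>\<omega>. (1 / real n) *\<^sub>R draws a X n \<omega>)) W
          in ennreal (c / real n) \<le> d\<^sub>X \<and> d\<^sub>X \<le> ennreal (C / real n) \<and>
             ennreal (c / real n) \<le> d\<^sub>Y \<and> d\<^sub>Y \<le> ennreal (C / real n)))"
proof -
  define v where "v = (1 / a) *\<^sub>R x\<^sub>0"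
  have v: "0 < v $ i" and v_nth: "v $ i = x\<^sub>0 $ i / a" for i using assms by (auto simp: v_def)
  define S where "S = (\<Sum>i\<in>UNIV. x\<^sub>0 $ i / a)"
  have S: "0 \<le> S" unfolding S_def using assms by (intro sum_nonneg) (auto simp: less_imp_le)
  \<comment> \<open>Stated as predicates so that the constants, and later the rounding maps, can be
    chosen as functions of the colours j and k.\<close>
  define lower where "lower j c \<longleftrightarrow> 0 < c \<and> (\<forall>k \<mu> L n p. j \<noteq> k \<longrightarrow> 1 \<le> n \<longrightarrow> 1 \<le> p \<longrightarrow> finite L \<longrightarrow> card L \<le> 2 * n \<longrightarrow>
      (AE x in \<mu>. x $ j \<in> L) \<longrightarrow> sets \<mu> = sets borel \<longrightarrow> ennreal (c / real n) \<le> lp_dist p \<mu> (dirichlet k v))" for j c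
  have "\<exists>c. lower j c" for j
    unfolding lower_def by (rule lp_dist_lattice_dirichlet_ge[OF v assms(1), of j]) blast
  then obtain c where "\<And>j. lower j (c j)" by metis
  note c = this[unfolded lower_def]
  define coupling where "coupling k C \<Psi> \<longleftrightarrow> 0 \<le> C \<and> (\<forall>n. \<Psi> n \<in> dirichlet k v \<rightarrow>\<^sub>M count_space (UNIV :: ('q \<Rightarrow> nat) set) \<and>
     (AE x in dirichlet k v. sum (\<Psi> n x) UNIV = n \<and> l1norm ((\<chi> i. real (\<Psi> n x i)) - real n *\<^sub>R x) \<le> C) \<and>
     (\<forall>m. sum m UNIV = n \<longrightarrow> measure (dirichlet k v) {x. \<Psi> n x = m} =
        (\<Prod>i\<in>UNIV. polya_weight (v $ i) (m i)) / polya_weight (\<Sum>i\<in>UNIV. v $ i) n))" for k C \<Psi>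
  have "\<exists>C \<Psi>. coupling k C \<Psi>" for k
    unfolding coupling_def by (rule dirichlet_coupling[OF v, of k]) blast
  then obtain C \<Psi> where "\<And>k. coupling k (C k) (\<Psi> k)" by metis
  note C\<Psi> = this[unfolded coupling_def]
  \<comment> \<open>The lower constant varies with the tested colour j and the upper one with the
    omitted colour k, but both must be fixed before k. Extremes over the finitely many colours
    achieve this. The term 2 * S pays for normalising the urn state, and the outer maximum ensures
    c' \<le> C'.\<close>
  define c' where "c' = Min (range c)"
  define C' where "C' = max c' (Max (range C) + 2 * S)"
  have c': "0 < c'" "c' \<le> c j" for j using c by (auto simp: c'_def)
  have C'_ge: "C k + 2 * S \<le> C'" for k
  proof -
    have "C k \<le> Max (range C)" by simp
    then show ?thesis unfolding C'_def by linarith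
  qed
  show ?thesis
  proof (rule exI[of _ c'], rule exI[of _ C'], intro conjI allI impI)
    show "0 < c'" by (rule c')
    show "c' \<le> C'" by (simp add: C'_def)
    fix M :: "'w measure" and X and k :: 'q and p :: ennreal and n :: nat
    assume urn: "polya_urn M a x\<^sub>0 X" and p: "1 \<le> p" and n: "1 \<le> n"
    interpret polya_urn_process M a x\<^sub>0 X
      using urn assms(2,3) by (rule polya_urn_process.intro)
    \<comment> \<open>The beta marginal is available for coordinates other than k; two colours leave
      at least one.\<close>
    obtain j where j: "j \<noteq> k"
    proof -
      have "(UNIV :: 'q set) \<noteq> {k}"
      proof
        assume "(UNIV :: 'q set) = {k}"
        then have "CARD('q) = card {k}" by (rule arg_cong)
        with assms(1) show False by simp
      qed
      then show ?thesis using that by auto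
    qed
    define fX where "fX \<omega> = (1 / l1norm (X n \<omega>)) *\<^sub>R X n \<omega>" for \<omega>
    define gX where "gX y = (1 / l1norm (urn_state a x\<^sub>0 y)) *\<^sub>R urn_state a x\<^sub>0 y" for y
    define fY where "fY \<omega> = (1 / real n) *\<^sub>R draws a X n \<omega>" for \<omega>
    define gY where "gY y = (1 / real n) *\<^sub>R (\<chi> i. real (y i))" for y :: "'q \<Rightarrow> nat"
    have fX_meas: "fX \<in> borel_measurable M"
      unfolding fX_def by measurable
    have fY_eq: "fY \<omega> = gY (draw_count a X n \<omega>)" for \<omega>
      by (simp add: fY_def gY_def draws_draw_count)
    have fY_meas: "fY \<in> borel_measurable M"
      unfolding fY_eq by (rule measurable_compose[OF draw_count_measurable]) simp
    have fX_eq: "AE \<omega> in M. fX \<omega> = gX (draw_count a X n \<omega>)"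
      using AE_urn_state[of n] by eventually_elim (simp add: fX_def gX_def)
    have card_image: "card (h ` {..n}) \<le> 2 * n" for h :: "nat \<Rightarrow> real"
      using card_image_le[of "{..n}" h] n by simp
    have ge: "ennreal (c' / real n) \<le> lp_dist p (distr M borel f) (dirichlet k v)"
      if f: "f \<in> borel_measurable M" "AE \<omega> in M. f \<omega> $ j \<in> h ` {..n}" for f h
    proof -
      have "{x. x $ j \<in> h ` {..n}} = (\<Union>i\<le>n. {x :: real^'q. x $ j = h i})" by auto
      moreover have "\<dots> \<in> sets borel" by (intro sets.finite_UN) auto
      ultimately have AE: "AE x in distr M borel f. x $ j \<in> h ` {..n}"
        using f by (subst AE_distr_iff) auto
      have "finite (h ` {..n})" "sets (distr M borel f) = sets borel" by simp_all
      with AE have "ennreal (c j / real n) \<le> lp_dist p (distr M borel f) (dirichlet k v)"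
        using c[of j] j n p card_image[of h] by blast
      moreover have "ennreal (c' / real n) \<le> ennreal (c j / real n)"
        using c'(2)[of j] n by (intro ennreal_leI divide_right_mono) auto
      ultimately show ?thesis by (rule order_trans[rotated])
    qed
    have upper: "lp_dist p (distr M borel f) (dirichlet k v) \<le> ennreal (C' / real n)"
      if f: "f \<in> borel_measurable M" "AE \<omega> in M. f \<omega> = g (draw_count a X n \<omega>)"
        and g: "\<And>y x. sum y UNIV = n \<Longrightarrow> (\<And>i. 0 < x $ i) \<Longrightarrow> (\<Sum>i\<in>UNIV. x $ i) = 1 \<Longrightarrow>
          l1norm ((\<chi> i. real (y i)) - real n *\<^sub>R x) \<le> C k \<Longrightarrow> l1norm (g y - x) \<le> (C k + 2 * S) / real n" for f g
    proof (rule lp_dist_urn_le[where \<Psi>="\<Psi> k n"])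
      show "prob_space (dirichlet k v)" by (rule prob_space_dirichlet[OF v])
      have AE: "AE x in dirichlet k v. sum (\<Psi> k n x) UNIV = n \<and> l1norm ((\<chi> i. real (\<Psi> k n x i)) - real n *\<^sub>R x) \<le> C k"
        using C\<Psi>[of k] by blast
      then show "AE x in dirichlet k v. sum (\<Psi> k n x) UNIV = n" by eventually_elim simp
      have C'n: "(C k + 2 * S) / real n \<le> C' / real n"
        using C'_ge[of k] n by (intro divide_right_mono) auto
      show "AE x in dirichlet k v. l1norm (g (\<Psi> k n x) - x) \<le> C' / real n"
        using AE AE_dirichlet
      proof eventually_elim
        case (elim x)
        then have "l1norm (g (\<Psi> k n x) - x) \<le> (C k + 2 * S) / real n" by (intro g) auto
        with C'n show ?case by linarith
      qed
      have "0 \<le> C'" using C'_ge[of k] C\<Psi>[of k] S by linarith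
      then show "0 \<le> C' / real n" by simp
      show "\<Psi> k n \<in> dirichlet k v \<rightarrow>\<^sub>M count_space UNIV" using C\<Psi>[of k] by blast
      show "measure (dirichlet k v) {x. \<Psi> k n x = m} =
        (\<Prod>i\<in>UNIV. polya_weight (x\<^sub>0 $ i / a) (m i)) / polya_weight (\<Sum>i\<in>UNIV. x\<^sub>0 $ i / a) n"
        if "sum m UNIV = n" for m
        using C\<Psi>[of k] that unfolding v_nth by blast
    qed (use f p in \<open>auto simp: sets_dirichlet\<close>)
    have "ennreal (c' / real n) \<le> lp_dist p (distr M borel fX) (dirichlet k v)"
    \<comment> \<open>The total S + n is deterministic, so coordinate j depends only on the count m
      in {0..n} of colour j.\<close>
    proof (rule ge[OF fX_meas, of "\<lambda>m. (x\<^sub>0 $ j / a + real m) / (S + real n)"])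
      show "AE \<omega> in M. fX \<omega> $ j \<in> (\<lambda>m. (x\<^sub>0 $ j / a + real m) / (S + real n)) ` {..n}"
        using fX_eq AE_urn_state[of n]
      proof eventually_elim
        case (elim \<omega>)
        let ?y = "draw_count a X n \<omega>"
        have norm: "l1norm (urn_state a x\<^sub>0 ?y) = a * (S + real n)"
          using l1norm_urn_state[OF assms(2,3), of ?y] elim unfolding S_def by (simp del: of_nat_sum)
        have "fX \<omega> = (1 / (a * (S + real n))) *\<^sub>R urn_state a x\<^sub>0 ?y"
          using elim unfolding gX_def norm by simp
        then have "fX \<omega> $ j = (x\<^sub>0 $ j + a * real (?y j)) / (a * (S + real n))"
          by (simp add: urn_state_def)
        also have "\<dots> = (x\<^sub>0 $ j / a + real (?y j)) / (S + real n)"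
          using assms(2) by (simp add: add_divide_distrib)
        finally have "fX \<omega> $ j = (x\<^sub>0 $ j / a + real (?y j)) / (S + real n)" .
        moreover have "?y j \<le> n"
          using elim member_le_sum[of j UNIV ?y] by simp
        ultimately show ?case by blast
      qed
    qed
    moreover have "ennreal (c' / real n) \<le> lp_dist p (distr M borel fY) (dirichlet k v)"
    proof (rule ge[OF fY_meas, of "\<lambda>m. real m / real n"])
      show "AE \<omega> in M. fY \<omega> $ j \<in> (\<lambda>m. real m / real n) ` {..n}"
        using AE_urn_state[of n]
      proof eventually_elim
        case (elim \<omega>)
        then have "draw_count a X n \<omega> j \<le> n"
          using member_le_sum[of j UNIV "draw_count a X n \<omega>"] by simp
        then show ?case by (auto simp: fY_eq gY_def)
      qed
    qed
    moreover have "lp_dist p (distr M borel fX) (dirichlet k v) \<le> ennreal (C' / real n)"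
      using fX_meas fX_eq
    proof (rule upper)
      show "l1norm (gX y - x) \<le> (C k + 2 * S) / real n"
        if "sum y UNIV = n" "\<And>i. 0 < x $ i" "(\<Sum>i\<in>UNIV. x $ i) = 1"
          "l1norm ((\<chi> i. real (y i)) - real n *\<^sub>R x) \<le> C k" for y x
        unfolding gX_def S_def by (rule normalized_urn_state_close[OF assms(2,3) n that])
    qed
    moreover have "lp_dist p (distr M borel fY) (dirichlet k v) \<le> ennreal (C' / real n)"
      using fY_meas
    proof (rule upper)
      show "AE \<omega> in M. fY \<omega> = gY (draw_count a X n \<omega>)" by (simp add: fY_eq)
      fix y and x :: "real^'q" assume close: "l1norm ((\<chi> i. real (y i)) - real n *\<^sub>R x) \<le> C k"
      have "gY y - x = (1 / real n) *\<^sub>R ((\<chi> i. real (y i)) - real n *\<^sub>R x)"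
        using n by (simp add: gY_def scaleR_right_diff_distrib)
      then have "l1norm (gY y - x) = l1norm ((\<chi> i. real (y i)) - real n *\<^sub>R x) / real n"
        by (simp only: l1norm_scaleR) simp
      also have "\<dots> \<le> (C k + 2 * S) / real n"
        using close S n by (intro divide_right_mono) auto
      finally show "l1norm (gY y - x) \<le> (C k + 2 * S) / real n" .
    qed
    ultimately show "let W = dirichlet k ((1 / a) *\<^sub>R x\<^sub>0);
              d\<^sub>X = lp_dist p (distr M borel (\<lambda>\<omega>. (1 / l1norm (X n \<omega>)) *\<^sub>R X n \<omega>)) W;
              d\<^sub>Y = lp_dist p (distr M borel (\<lambda>\<omega>. (1 / real n) *\<^sub>R draws a X n \<omega>)) W
          in ennreal (c' / real n) \<le> d\<^sub>X \<and> d\<^sub>X \<le> ennreal (C' / real n) \<and>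
             ennreal (c' / real n) \<le> d\<^sub>Y \<and> d\<^sub>Y \<le> ennreal (C' / real n)"
      unfolding Let_def v_def[symmetric] fX_def[symmetric] fY_def[symmetric] by blast
  qed
qed

end
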